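(* Let $p$ be a prime and let $l,m$ be integers with $|m|\geqslant l>0$. The group $G(l,m)=\langle a,b;\ b^{-1}a^{l}b=a^{m}\rangle$ is residually a finite $p$-group if and only if either $l=1$ and $m\equiv 1\pmod p$, or $|m|=l=p^{r}$ for some integer $r\geqslant 0$ and also if $m=-l$ then $p=2$.
   Context: A group is residually a finite $p$-group if for each of its non-identity elements $g$ there is a homomorphism onto a finite $p$-group whose value at $g$ is not $1$. *)

theory Defs
  imports
    "HOL-Algebra.Coset"
    "HOL-Number_Theory.Cong"
    "HOL-Computational_Algebra.Primes"
begin

section \<open>Free groups as groups of reduced words\<close>

text \<open>The letter \<open>(x, True)\<close> stands for the generator \<open>x\<close>, and \<open>(x, False)\<close> for its inverse.\<close>

type_synonym 'g word = "('g \<times> bool) list"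

definition flip :: "'g \<times> bool \<Rightarrow> 'g \<times> bool" where
  "flip c = (fst c, \<not> snd c)"

definition reduced :: "'g word \<Rightarrow> bool" where
  "reduced w \<longleftrightarrow> successively (\<lambda>c d. d \<noteq> flip c) w"

fun push :: "'g \<times> bool \<Rightarrow> 'g word \<Rightarrow> 'g word" where
  "push c [] = [c]"
| "push c (d # w) = (if d = flip c then w else c # d # w)"

text \<open>For reduced \<open>u\<close> and \<open>v\<close>, \<open>foldr push u v\<close> is the reduced form of the concatenation \<open>u @ v\<close>.
  The generators are all the elements of the type \<open>'g\<close>.\<close>

definition free_group :: "'g word monoid" where
  "free_group = \<lparr>carrier = {w. reduced w}, monoid.mult = foldr push, one = []\<rparr>"

definition free_gen :: "'g \<Rightarrow> 'g word" where
  "free_gen x = [(x, True)]"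

lemma flip_flip [simp]: "flip (flip c) = c"
  by (simp add: flip_def)

lemma flip_neq [simp]: "flip c \<noteq> c" "c \<noteq> flip c"
  by (cases c; simp add: flip_def)+

lemma reduced_Nil [simp]: "reduced []"
  by (simp add: reduced_def)

lemma reduced_single [simp]: "reduced [c]"
  by (simp add: reduced_def)

lemma reduced_Cons_Cons [simp]: "reduced (c # d # w) \<longleftrightarrow> d \<noteq> flip c \<and> reduced (d # w)"
  by (simp add: reduced_def)

lemma reduced_tl: "reduced (c # w) \<Longrightarrow> reduced w"
  by (cases w) simp_all

lemma reduced_push: "reduced w \<Longrightarrow> reduced (push c w)"
  by (cases w) (auto intro: reduced_tl)

lemma reduced_foldr_push: "reduced v \<Longrightarrow> reduced (foldr push u v)"
  by (induction u) (simp_all add: reduced_push)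

lemma push_reduced: "reduced (c # w) \<Longrightarrow> push c w = c # w"
  by (cases w) simp_all

lemma push_push_flip: "reduced w \<Longrightarrow> push c (push (flip c) w) = w"
proof (cases w)
  case (Cons d w')
  assume "reduced w"
  with Cons show ?thesis
    by (cases w') auto
qed simp

lemma foldr_push_Nil: "reduced u \<Longrightarrow> foldr push u [] = u"
proof (induction u)
  case (Cons c u)
  then show ?case
    using reduced_tl[of c u] push_reduced[of c u] by simp
qed simp

lemma foldr_push_push:
  assumes "reduced w"
  shows "foldr push (push c u) w = push c (foldr push u w)"
proof (cases u)
  case (Cons d u')
  show ?thesis
  proof (cases "d = flip c")
    case True
    then show ?thesis
      using Cons push_push_flip[of "foldr push u' w" c] reduced_foldr_push[OF assms] by simp
  qed (simp add: Cons)
qed simp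

lemma foldr_push_assoc:
  "reduced w \<Longrightarrow> foldr push (foldr push u v) w = foldr push u (foldr push v w)"
  by (induction u) (simp_all add: foldr_push_push)

lemma foldr_push_inverse:
  "reduced w \<Longrightarrow> foldr push (rev (map flip u)) (foldr push u w) = w"
proof (induction u arbitrary: w)
  case (Cons c u)
  then show ?case
    using push_push_flip[of "foldr push u w" "flip c"] reduced_foldr_push[of w u] by simp
qed simp

lemma group_free_group: "group (free_group :: 'g word monoid)"
proof (rule groupI)
  fix u :: "'g word"
  assume "u \<in> carrier free_group"
  then have u: "reduced u"
    by (simp add: free_group_def)
  define v where "v = foldr push (rev (map flip u)) []"
  have "foldr push v u = []"
    using u foldr_push_inverse[of "[]" u]
    by (simp add: v_def foldr_push_assoc foldr_push_Nil)
  moreover have "reduced v"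
    by (simp add: v_def reduced_foldr_push)
  ultimately show "\<exists>v\<in>carrier free_group. v \<otimes>\<^bsub>free_group\<^esub> u = \<one>\<^bsub>free_group\<^esub>"
    by (auto simp: free_group_def)
qed (simp_all add: free_group_def reduced_foldr_push foldr_push_assoc)

lemma free_gen_closed: "free_gen x \<in> carrier free_group"
  by (simp add: free_group_def free_gen_def)


section \<open>Presentations\<close>

definition normal_closure :: "('a, 'b) monoid_scheme \<Rightarrow> 'a set \<Rightarrow> 'a set" where
  "normal_closure G R = \<Inter> {N. N \<lhd> G \<and> R \<subseteq> N}"

definition presented_group :: "'g word set \<Rightarrow> 'g word set monoid" where
  "presented_group R = free_group Mod normal_closure free_group R"

lemma (in group) normal_closure_normal:
  assumes "R \<subseteq> carrier G"
  shows "normal_closure G R \<lhd> G"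
proof -
  let ?C = "{N. N \<lhd> G \<and> R \<subseteq> N}"
  have "carrier G \<lhd> G"
    by (simp add: normal_invI subgroup_self)
  with assms have ne: "?C \<noteq> {}"
    by blast
  have "subgroup (\<Inter> ?C) G"
    by (rule subgroups_Inter) (use ne in \<open>auto intro: normal_imp_subgroup\<close>)
  then show ?thesis
    unfolding normal_closure_def
    by (rule normal_invI) (auto intro: normal.inv_op_closed2)
qed

lemma group_presented_group:
  assumes "R \<subseteq> carrier (free_group :: 'g word monoid)"
  shows "group (presented_group R)"
  unfolding presented_group_def
  by (intro normal.factorgroup_is_group group.normal_closure_normal group_free_group assms)


section \<open>The groups \<open>G(l,m)\<close>\<close>

datatype gen = A | B

definition G_relator :: "int \<Rightarrow> int \<Rightarrow> gen word" where
  "G_relator l m =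
     inv\<^bsub>free_group\<^esub> free_gen B \<otimes>\<^bsub>free_group\<^esub> free_gen A [^]\<^bsub>free_group\<^esub> l
       \<otimes>\<^bsub>free_group\<^esub> free_gen B \<otimes>\<^bsub>free_group\<^esub> inv\<^bsub>free_group\<^esub> (free_gen A [^]\<^bsub>free_group\<^esub> m)"

definition G_group :: "int \<Rightarrow> int \<Rightarrow> gen word set monoid" where
  "G_group l m = presented_group {G_relator l m}"

lemma group_G_group: "group (G_group l m)"
proof -
  interpret F: group "free_group :: gen word monoid"
    by (rule group_free_group)
  show ?thesis
    unfolding G_group_def
    by (rule group_presented_group) (simp add: G_relator_def free_gen_closed)
qed


section \<open>Residually finite \<open>p\<close>-groups\<close>

definition finite_p_group :: "nat \<Rightarrow> ('a, 'b) monoid_scheme \<Rightarrow> bool" where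
  "finite_p_group p H \<longleftrightarrow> group H \<and> finite (carrier H) \<and> (\<exists>n. order H = p ^ n)"

text \<open>Types cannot be quantified over. Taking the carrier of the finite quotient inside \<open>nat\<close> is no
  restriction, as every finite group has an isomorphic copy there; see \<open>residually_finite_pI\<close>.\<close>

definition residually_finite_p :: "nat \<Rightarrow> ('a, 'b) monoid_scheme \<Rightarrow> bool" where
  "residually_finite_p p G \<longleftrightarrow>
     (\<forall>g\<in>carrier G. g \<noteq> \<one>\<^bsub>G\<^esub> \<longrightarrow>
        (\<exists>(H :: nat monoid) h. finite_p_group p H \<and> h \<in> epi G H \<and> h g \<noteq> \<one>\<^bsub>H\<^esub>))"

lemma finite_p_group_nat_copy:
  fixes K :: "('c, 'd) monoid_scheme"
  assumes K: "finite_p_group p K"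
  obtains H :: "nat monoid" and f where "finite_p_group p H" "f \<in> iso K H"
proof -
  interpret K: group K
    using K by (simp add: finite_p_group_def)
  obtain f :: "'c \<Rightarrow> nat" where f: "inj_on f (carrier K)"
    using K by (meson finite_imp_inj_to_nat_seg finite_p_group_def)
  define g where "g = the_inv_into (carrier K) f"
  define H :: "nat monoid" where
    "H = \<lparr>carrier = f ` carrier K, monoid.mult = (\<lambda>x y. f (g x \<otimes>\<^bsub>K\<^esub> g y)), one = f \<one>\<^bsub>K\<^esub>\<rparr>"
  have g: "g (f x) = x" if "x \<in> carrier K" for x
    using that f by (simp add: g_def the_inv_into_f_f)
  have iso: "f \<in> iso K H"
    using f by (auto simp: iso_def hom_def H_def bij_betw_def g)
  have "group H"
  proof (rule groupI)
    fix x assume "x \<in> carrier H"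
    then obtain y where y: "y \<in> carrier K" "x = f y"
      by (auto simp: H_def)
    then show "\<exists>z\<in>carrier H. z \<otimes>\<^bsub>H\<^esub> x = \<one>\<^bsub>H\<^esub>"
      by (auto simp: H_def g intro!: bexI[of _ "inv\<^bsub>K\<^esub> y"])
  qed (auto simp: H_def g K.m_assoc)
  moreover have "order H = order K"
    using f by (simp add: order_def H_def card_image)
  moreover have "finite (carrier H)"
    using K by (simp add: H_def finite_p_group_def)
  ultimately have "finite_p_group p H"
    using K by (simp add: finite_p_group_def)
  then show thesis
    using iso by (rule that)
qed

lemma residually_finite_pI:
  fixes G :: "('a, 'b) monoid_scheme"
  assumes G: "group G"
    and ex: "\<And>g. g \<in> carrier G \<Longrightarrow> g \<noteq> \<one>\<^bsub>G\<^esub> \<Longrightarrow>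
      \<exists>(K :: 'c monoid) k. finite_p_group p K \<and> k \<in> epi G K \<and> k g \<noteq> \<one>\<^bsub>K\<^esub>"
  shows "residually_finite_p p G"
  unfolding residually_finite_p_def
proof (intro ballI impI)
  fix g assume g: "g \<in> carrier G" "g \<noteq> \<one>\<^bsub>G\<^esub>"
  obtain K :: "'c monoid" and k where K: "finite_p_group p K" "k \<in> epi G K" "k g \<noteq> \<one>\<^bsub>K\<^esub>"
    using ex[OF g] by blast
  obtain H :: "nat monoid" and f where H: "finite_p_group p H" "f \<in> iso K H"
    using finite_p_group_nat_copy[OF K(1)] .
  have k: "k \<in> hom G K" "k ` carrier G = carrier K"
    using K(2) by (auto simp: epi_def)
  have f: "f \<in> hom K H" "f ` carrier K = carrier H" "inj_on f (carrier K)"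
    using H(2) by (auto simp: iso_def bij_betw_def)
  have grp: "group K" "group H"
    using K(1) H(1) by (simp_all add: finite_p_group_def)
  have "f \<circ> k \<in> epi G H"
    using Group.hom_compose[OF k(1) f(1)] k(2) f(2) by (simp add: epi_def image_comp [symmetric] del: image_comp o_apply)
  moreover have "(f \<circ> k) g \<noteq> \<one>\<^bsub>H\<^esub>"
  proof
    assume "(f \<circ> k) g = \<one>\<^bsub>H\<^esub>"
    then have "f (k g) = f \<one>\<^bsub>K\<^esub>"
      using hom_one[OF f(1) grp] by simp
    then have "k g = \<one>\<^bsub>K\<^esub>"
      using f(3) k(2) g(1) grp(1) by (metis group.is_monoid imageI inj_onD monoid.one_closed)
    with K(3) show False ..
  qed
  ultimately show "\<exists>(H :: nat monoid) h. finite_p_group p H \<and> h \<in> epi G H \<and> h g \<noteq> \<one>\<^bsub>H\<^esub>"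
    using H(1) by blast
qed

end

theory Submission
  imports
    Defs
    "HOL-Library.Countable_Set"
    "HOL-Number_Theory.Residues"
    "HOL-Algebra.Sylow"
    "HOL-Combinatorics.Permutations"
begin

text \<open>
  Necessity. If \<open>b\<^sup>-\<^sup>1 y b = y\<^sup>c\<close> in a finite \<open>p\<close>-group, then \<open>y = y\<^sup>e\<close> for \<open>e = c\<close> raised to the order
  of \<open>b\<close>, and \<open>e \<equiv> c\<close> modulo \<open>p\<close>; so \<open>y = 1\<close> unless \<open>c \<equiv> 1\<close>. As \<open>a\<close> has infinite order in
  \<open>G(l,m)\<close>, this gives \<open>m/l \<equiv> 1\<close> modulo \<open>p\<close> whenever \<open>l\<close> divides \<open>m\<close>. Moreover, if \<open>q\<close> is the \<open>p\<close>-part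
  of \<open>l\<close>, then \<open>a\<^sup>q\<close> is a power of \<open>a\<^sup>l\<close> in every finite \<open>p\<close>-quotient, hence \<open>b\<^sup>-\<^sup>1 a\<^sup>q b\<close> commutes
  with \<open>a\<close> there. In \<open>G(l,m)\<close> this fails if \<open>q < l\<close> and \<open>\<bar>m\<bar> > 1\<close>, so \<open>l\<close> is a power of \<open>p\<close>; likewise for
  \<open>m\<close>. The facts about \<open>G(l,m)\<close> are read off from actions in which \<open>a\<close> is a translation of
  \<open>\<int> \<times> \<nat>\<close> and \<open>b\<close> is built from a bijection between the orbits of \<open>a\<^sup>m\<close> and those of \<open>a\<^sup>l\<close>.

  Sufficiency. For \<open>l = 1\<close> every element is of the form \<open>b\<^sup>i a\<^sup>k b\<^sup>-\<^sup>j\<close>, which is detected by the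
  exponent sum of \<open>b\<close> or by an action on \<open>\<int>/p\<^sup>n\<int>\<close> by affine maps. For \<open>m = \<plusminus>l\<close> the subgroup
  generated by \<open>a\<^sup>l\<close> is normal. Its elements are detected by affine maps as well, and the others map
  to nontrivial elements of the free product \<open>\<int>/p\<^sup>r * \<int>/p\<^sup>N\<close> for large \<open>N\<close>, which are detected by
  unipotent matrices over \<open>\<int>/p\<int>\<close> through a Magnus representation \<open>a \<mapsto> 1 + X\<close>, \<open>b \<mapsto> 1 + Y\<close>.
\<close>


section \<open>The universal property of \<open>G(l,m)\<close>\<close>

definition word_eval :: "('a, 'b) monoid_scheme \<Rightarrow> ('g \<Rightarrow> 'a) \<Rightarrow> 'g word \<Rightarrow> 'a" where
  "word_eval K f w =
     foldr (\<lambda>c z. (if snd c then f (fst c) else inv\<^bsub>K\<^esub> f (fst c)) \<otimes>\<^bsub>K\<^esub> z) w \<one>\<^bsub>K\<^esub>"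

lemma word_eval_simps [simp]:
  "word_eval K f [] = \<one>\<^bsub>K\<^esub>"
  "word_eval K f (c # w) = (if snd c then f (fst c) else inv\<^bsub>K\<^esub> f (fst c)) \<otimes>\<^bsub>K\<^esub> word_eval K f w"
  by (simp_all add: word_eval_def)

context group
begin

lemma word_eval_closed [simp]:
  assumes "\<And>x. f x \<in> carrier G"
  shows "word_eval G f w \<in> carrier G"
  using assms by (induction w) auto

lemma word_eval_push:
  assumes "\<And>x. f x \<in> carrier G"
  shows "word_eval G f (push c w) = word_eval G f (c # w)"
proof (cases w)
  case (Cons d w')
  show ?thesis
  proof (cases "d = flip c")
    case True
    with Cons assms show ?thesis
      by (cases "snd c") (simp_all add: flip_def m_assoc [symmetric])
  qed (simp add: Cons)
qed simp

lemma word_eval_foldr_push: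
  assumes "\<And>x. f x \<in> carrier G"
  shows "word_eval G f (foldr push u v) = word_eval G f u \<otimes> word_eval G f v"
  using assms by (induction u) (simp_all add: word_eval_push m_assoc)

lemma word_eval_hom:
  assumes "\<And>x. f x \<in> carrier G"
  shows "word_eval G f \<in> hom free_group G"
  using assms by (intro homI) (simp_all add: word_eval_foldr_push free_group_def)

text \<open>Von Dyck's theorem: the kernel of \<open>word_eval G f\<close> is normal and contains
  \<open>R\<close>, hence contains the normal closure, so the evaluation factors through the
  quotient.\<close>

lemma presented_group_universal:
  assumes f: "\<And>x. f x \<in> carrier G"
    and R: "R \<subseteq> carrier free_group" "\<And>w. w \<in> R \<Longrightarrow> word_eval G f w = \<one>"
  obtains h where "h \<in> hom (presented_group R) G"
    "\<And>w. w \<in> carrier free_group \<Longrightarrow>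
      h (normal_closure free_group R #>\<^bsub>free_group\<^esub> w) = word_eval G f w"
proof -
  interpret F: group "free_group :: 'c word monoid"
    by (rule group_free_group)
  interpret E: group_hom free_group G "word_eval G f"
    by unfold_locales (rule word_eval_hom[OF f])
  let ?N = "normal_closure free_group R"
  have N: "?N \<lhd> free_group"
    by (rule F.normal_closure_normal[OF R(1)])
  have "R \<subseteq> kernel free_group G (word_eval G f)"
    using R by (auto simp: kernel_def)
  then have "?N \<subseteq> kernel free_group G (word_eval G f)"
    unfolding normal_closure_def using E.normal_kernel by blast
  with N show thesis
    using E.FactGroup_universal_kernel that unfolding presented_group_def by blast
qed

end

lemma inv_free_gen: "inv\<^bsub>free_group\<^esub> (free_gen x) = [(x, False)]"
proof -
  interpret F: group "free_group :: 'a word monoid"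
    by (rule group_free_group)
  show ?thesis
    by (rule F.inv_equality) (simp_all add: free_gen_def free_group_def flip_def)
qed

definition G_gen :: "int \<Rightarrow> int \<Rightarrow> gen \<Rightarrow> gen word set" where
  "G_gen l m x =
     normal_closure free_group {G_relator l m} #>\<^bsub>free_group\<^esub> free_gen x"

lemma G_relator_closed: "G_relator l m \<in> carrier free_group"
proof -
  interpret F: group "free_group :: gen word monoid"
    by (rule group_free_group)
  show ?thesis
    by (simp add: G_relator_def free_gen_closed)
qed

context
  fixes l m :: int
begin

private abbreviation (input) "N \<equiv> normal_closure free_group {G_relator l m}"

interpretation F: group "free_group :: gen word monoid"
  by (rule group_free_group)

interpretation N: normal N "free_group :: gen word monoid"
  by (rule F.normal_closure_normal) (simp add: G_relator_closed)

interpretation G: group "G_group l m"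
  by (rule group_G_group)

interpretation q: group_hom free_group "G_group l m" "\<lambda>w. N #>\<^bsub>free_group\<^esub> w"
  unfolding G_group_def presented_group_def
  by (intro group_hom.intro group_hom_axioms.intro group_free_group N.factorgroup_is_group
      N.r_coset_hom_Mod)

lemma G_gen_closed [simp]: "G_gen l m x \<in> carrier (G_group l m)"
  by (simp add: G_gen_def free_gen_closed)

text \<open>An element is the coset of a reduced word, and prepending a letter is left
  multiplication by a generator or its inverse.\<close>

lemma G_group_induct [consumes 1, case_names one mult]:
  assumes "g \<in> carrier (G_group l m)"
    and one: "P \<one>\<^bsub>G_group l m\<^esub>"
    and mult: "\<And>g x z. g \<in> carrier (G_group l m) \<Longrightarrow> P g \<Longrightarrow> z \<in> {1, -1} \<Longrightarrow>
      P (G_gen l m x [^]\<^bsub>G_group l m\<^esub> (z :: int) \<otimes>\<^bsub>G_group l m\<^esub> g)"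
  shows "P g"
proof -
  have *: "P (N #>\<^bsub>free_group\<^esub> w)" if "reduced w" for w :: "gen word"
    using that
  proof (induction w)
    case Nil
    have "N #>\<^bsub>free_group\<^esub> [] = \<one>\<^bsub>G_group l m\<^esub>"
      using q.hom_one by (simp add: free_group_def)
    with one show ?case
      by simp
  next
    case (Cons c w)
    obtain x s where c: "c = (x, s)"
      by (cases c)
    define z :: int where "z = (if s then 1 else -1)"
    have w: "w \<in> carrier free_group"
      using reduced_tl[OF Cons.prems] by (simp add: free_group_def)
    have "c # w = [c] \<otimes>\<^bsub>free_group\<^esub> w"
      using push_reduced[OF Cons.prems] by (simp add: free_group_def)
    also have "[c] = free_gen x [^]\<^bsub>free_group\<^esub> z"
      by (cases s) (simp_all add: c z_def inv_free_gen free_gen_closed F.int_pow_neg, simp add: free_gen_def)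
    finally have "N #>\<^bsub>free_group\<^esub> (c # w) =
        G_gen l m x [^]\<^bsub>G_group l m\<^esub> z \<otimes>\<^bsub>G_group l m\<^esub> (N #>\<^bsub>free_group\<^esub> w)"
      using w by (simp add: free_gen_closed q.hom_int_pow G_gen_def del: N.rcos_sum)
    moreover have "P (N #>\<^bsub>free_group\<^esub> w)"
      using Cons reduced_tl by blast
    ultimately show ?case
      using mult[of "N #>\<^bsub>free_group\<^esub> w" z x] w by (simp add: z_def)
  qed
  obtain w where "w \<in> carrier free_group" "g = N #>\<^bsub>free_group\<^esub> w"
    using assms(1) by (auto simp: G_group_def presented_group_def carrier_FactGroup)
  with * show ?thesis
    by (simp add: free_group_def)
qed

lemma G_gen_relation:
  "inv\<^bsub>G_group l m\<^esub> G_gen l m B \<otimes>\<^bsub>G_group l m\<^esub> G_gen l m A [^]\<^bsub>G_group l m\<^esub> l \<otimes>\<^bsub>G_group l m\<^esub> G_gen l m B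
    = G_gen l m A [^]\<^bsub>G_group l m\<^esub> m"
proof -
  have "G_relator l m \<in> N"
    by (auto simp: normal_closure_def)
  then have "N #>\<^bsub>free_group\<^esub> G_relator l m = \<one>\<^bsub>G_group l m\<^esub>"
    using N.rcos_const by (simp add: G_group_def presented_group_def)
  moreover have "N #>\<^bsub>free_group\<^esub> (inv\<^bsub>free_group\<^esub> free_gen B \<otimes>\<^bsub>free_group\<^esub> free_gen A [^]\<^bsub>free_group\<^esub> l
      \<otimes>\<^bsub>free_group\<^esub> free_gen B \<otimes>\<^bsub>free_group\<^esub> inv\<^bsub>free_group\<^esub> (free_gen A [^]\<^bsub>free_group\<^esub> m)) =
      inv\<^bsub>G_group l m\<^esub> G_gen l m B \<otimes>\<^bsub>G_group l m\<^esub> G_gen l m A [^]\<^bsub>G_group l m\<^esub> l \<otimes>\<^bsub>G_group l m\<^esub> G_gen l m B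
      \<otimes>\<^bsub>G_group l m\<^esub> inv\<^bsub>G_group l m\<^esub> (G_gen l m A [^]\<^bsub>G_group l m\<^esub> m)"
    by (simp add: free_gen_closed q.hom_int_pow G_gen_def)
  ultimately have "inv\<^bsub>G_group l m\<^esub> G_gen l m B \<otimes>\<^bsub>G_group l m\<^esub> G_gen l m A [^]\<^bsub>G_group l m\<^esub> l \<otimes>\<^bsub>G_group l m\<^esub> G_gen l m B
     \<otimes>\<^bsub>G_group l m\<^esub> inv\<^bsub>G_group l m\<^esub> (G_gen l m A [^]\<^bsub>G_group l m\<^esub> m) = \<one>\<^bsub>G_group l m\<^esub>"
    by (simp only: flip: G_relator_def)
  then show ?thesis
    by (metis G.inv_solve_right G.int_pow_closed G.inv_closed G.l_one G.m_closed G.one_closed G_gen_closed)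
qed

end

text \<open>The relation is asked in a form free of inverses, which for maps is a plain identity
  between compositions.\<close>

lemma (in group) G_group_universal:
  assumes x: "x \<in> carrier G" and y: "y \<in> carrier G"
    and rel: "x [^] l \<otimes> y = y \<otimes> x [^] m"
  obtains h where "h \<in> hom (G_group l m) G" "h (G_gen l m A) = x" "h (G_gen l m B) = y"
proof -
  define f where "f = (\<lambda>c. case c of A \<Rightarrow> x | B \<Rightarrow> y)"
  have f: "f c \<in> carrier G" for c
    using x y by (simp add: f_def split: gen.split)
  interpret F: group "free_group :: gen word monoid"
    by (rule group_free_group)
  interpret E: group_hom free_group G "word_eval G f"
    by unfold_locales (rule word_eval_hom[OF f])
  have gen: "word_eval G f (free_gen c) = f c" for c
    using f by (simp add: free_gen_def)
  have "word_eval G f (G_relator l m) = inv y \<otimes> x [^] l \<otimes> y \<otimes> inv (x [^] m)"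
    by (simp add: G_relator_def free_gen_closed E.hom_int_pow gen) (simp add: f_def)
  also have "\<dots> = inv y \<otimes> (y \<otimes> x [^] m) \<otimes> inv (x [^] m)"
    using x y by (simp add: m_assoc flip: rel)
  also have "\<dots> = \<one>"
    using x y by (simp add: m_assoc[symmetric])
  finally have rel1: "word_eval G f (G_relator l m) = \<one>" .
  obtain h where h: "h \<in> hom (presented_group {G_relator l m}) G"
    "\<And>w. w \<in> carrier free_group \<Longrightarrow>
      h (normal_closure free_group {G_relator l m} #>\<^bsub>free_group\<^esub> w) = word_eval G f w"
    using presented_group_universal[of f "{G_relator l m}"] f G_relator_closed[of l m] rel1 by auto
  show thesis
    by (rule that[of h]) (simp_all add: h G_group_def G_gen_def free_gen_closed gen, simp_all add: f_def)
qed


section \<open>Actions of \<open>G(l,m)\<close> on \<open>\<int> \<times> \<nat>\<close>\<close>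

definition fun_group :: "('x \<Rightarrow> 'x) set \<Rightarrow> ('x \<Rightarrow> 'x) monoid" where
  "fun_group C = \<lparr>carrier = C, monoid.mult = (\<circ>), one = id\<rparr>"

lemma fun_group_simps [simp]:
  "carrier (fun_group C) = C" "f \<otimes>\<^bsub>fun_group C\<^esub> g = f \<circ> g" "\<one>\<^bsub>fun_group C\<^esub> = id"
  by (simp_all add: fun_group_def)

lemma group_fun_group:
  assumes "id \<in> C" "\<And>f g. f \<in> C \<Longrightarrow> g \<in> C \<Longrightarrow> f \<circ> g \<in> C" "\<And>f. f \<in> C \<Longrightarrow> \<exists>g\<in>C. g \<circ> f = id"
  shows "group (fun_group C)"
  by (rule groupI) (use assms in \<open>auto simp: comp_assoc\<close>)

lemma fun_group_nat_pow: "f [^]\<^bsub>fun_group C\<^esub> (n :: nat) = f ^^ n"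
  by (induction n) (simp_all add: nat_pow_def funpow_Suc_right del: funpow.simps(2))

abbreviation Bij_group :: "('x \<Rightarrow> 'x) monoid" where
  "Bij_group \<equiv> fun_group {f. bij f}"

lemma group_Bij_group: "group Bij_group"
  by (rule group_fun_group)
    (auto intro: bij_comp bij_imp_bij_inv simp: bij_is_inj)

text \<open>The infinitely many rows give every shift countably infinitely many orbits, so the
  orbits of two shifts can be matched freely.\<close>

definition row_shift :: "int \<Rightarrow> int \<times> nat \<Rightarrow> int \<times> nat" where
  "row_shift z x = (fst x + z, snd x)"

lemma row_shift_comp: "row_shift y \<circ> row_shift z = row_shift (y + z)"
  by (auto simp: row_shift_def)

lemma row_shift_0: "row_shift 0 = id"
  by (auto simp: row_shift_def)

lemma bij_row_shift: "bij (row_shift z)"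
  by (rule o_bij[of "row_shift (- z)"]) (simp_all add: row_shift_comp row_shift_0)

lemma row_shift_pow: "row_shift 1 [^]\<^bsub>Bij_group\<^esub> (z :: int) = row_shift z"
proof -
  interpret group "Bij_group :: (int \<times> nat \<Rightarrow> int \<times> nat) monoid"
    by (rule group_Bij_group)
  have nat: "row_shift 1 ^^ n = row_shift (int n)" for n
    by (induction n) (simp_all add: row_shift_0 row_shift_comp add.commute)
  have "inv\<^bsub>Bij_group\<^esub> row_shift z = row_shift (- z)" for z
    by (rule inv_equality) (simp_all add: bij_row_shift row_shift_comp row_shift_0)
  then show ?thesis
    by (simp add: int_pow_def2 fun_group_nat_pow nat)
qed

text \<open>Removing \<open>F\<close> and its image leaves two countably infinite sets, which both
  biject with the natural numbers.\<close>

lemma extend_finite_bij: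
  assumes X: "infinite X" "countable X" and Y: "infinite Y" "countable Y"
    and F: "finite F" "F \<subseteq> X" and f: "inj_on f F" "f ` F \<subseteq> Y"
  obtains g where "bij_betw g X Y" "\<And>x. x \<in> F \<Longrightarrow> g x = f x"
proof -
  have "infinite (X - F)" "countable (X - F)" "infinite (Y - f ` F)" "countable (Y - f ` F)"
    using X Y F by (auto simp: Diff_infinite_finite)
  then obtain u v where u: "bij_betw u (X - F) (UNIV :: nat set)"
      and v: "bij_betw v (Y - f ` F) (UNIV :: nat set)"
    by (metis countableE_infinite)
  define h where "h = inv_into (Y - f ` F) v \<circ> u"
  have h: "bij_betw h (X - F) (Y - f ` F)"
    unfolding h_def using bij_betw_trans[OF u bij_betw_inv_into[OF v]] .
  let ?g = "\<lambda>x. if x \<in> F then f x else h x"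
  have "bij_betw ?g F (f ` F)"
    using inj_on_imp_bij_betw[OF f(1)] by (subst bij_betw_cong[where g = f]) auto
  moreover have "bij_betw ?g (X - F) (Y - f ` F)"
    using h by (subst bij_betw_cong[where g = h]) auto
  ultimately have "bij_betw ?g (F \<union> (X - F)) (f ` F \<union> (Y - f ` F))"
    by (rule bij_betw_combine) blast
  with F f have "bij_betw ?g X Y"
    by (simp add: Un_absorb1 Un_Diff_cancel)
  then show thesis
    by (rule that) simp
qed

text \<open>One representative of each orbit of \<open>row_shift m\<close>. The range of
  \<open>mod\<close> is used because for negative \<open>m\<close> the residues are not
  positive.\<close>

definition row_residues :: "int \<Rightarrow> (int \<times> nat) set" where
  "row_residues m = range (\<lambda>z. z mod m) \<times> UNIV"

lemma infinite_row_residues: "infinite (row_residues m)"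
  by (auto simp: row_residues_def finite_cartesian_product_iff)

text \<open>A bijection between the orbits of \<open>row_shift m\<close> and those of \<open>row_shift l\<close>, with orbits
  represented by residues, induces a bijection of \<open>\<int> \<times> \<nat>\<close> intertwining the two shifts.\<close>

lemma intertwiner:
  assumes "m \<noteq> 0" "l \<noteq> 0" and \<phi>: "bij_betw \<phi> (row_residues m) (row_residues l)"
  obtains \<beta> where "bij \<beta>" "row_shift l \<circ> \<beta> = \<beta> \<circ> row_shift m"
    "\<And>z i. \<beta> (z, i) = row_shift (l * (z div m)) (\<phi> (z mod m, i))"
proof -
  \<comment> \<open>\<open>T\<close> keeps \<open>l\<close>, \<open>m\<close> and
    \<open>\<phi>\<close> as arguments since its inverse has the same form, with \<open>l\<close>
    and \<open>m\<close> exchanged and \<open>\<phi>\<close> inverted.\<close>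
  define T where "T l m \<phi> x = row_shift (l * (fst x div m)) (\<phi> (fst x mod m, snd x))"
    for l m :: int and \<phi> :: "int \<times> nat \<Rightarrow> int \<times> nat" and x
  define \<psi> where "\<psi> = inv_into (row_residues m) \<phi>"
  have \<psi>: "bij_betw \<psi> (row_residues l) (row_residues m)"
    unfolding \<psi>_def by (rule bij_betw_inv_into[OF \<phi>])
  have TT: "T m l \<psi> (T l m \<phi> x) = x"
    if "l \<noteq> 0" "bij_betw \<phi> (row_residues m) (row_residues l)"
       "\<And>y. y \<in> row_residues m \<Longrightarrow> \<psi> (\<phi> y) = y" for l m \<phi> \<psi> x
  proof -
    define y where "y = (fst x mod m, snd x)"
    have y: "y \<in> row_residues m"
      by (simp add: y_def row_residues_def)
    with that(2) have "\<phi> y \<in> row_residues l"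
      by (meson bij_betwE)
    then obtain r where r: "fst (\<phi> y) = r mod l"
      by (auto simp: row_residues_def)
    define k where "k = fst x div m"
    have \<phi>y: "\<phi> y = (r mod l, snd (\<phi> y))"
      by (simp flip: r)
    have "T l m \<phi> x = (r mod l + l * k, snd (\<phi> y))"
      unfolding T_def k_def[symmetric] y_def[symmetric] row_shift_def r ..
    moreover have "(r mod l + l * k) div l = k" "(r mod l + l * k) mod l = r mod l"
      using that(1) by (simp_all add: add.commute)
    ultimately have "T m l \<psi> (T l m \<phi> x) = row_shift (m * k) (\<psi> (\<phi> y))"
      by (subst \<phi>y) (simp add: T_def[of m])
    also have "\<dots> = x"
      by (simp add: that(3)[OF y]) (simp add: row_shift_def y_def k_def)
    finally show ?thesis .
  qed
  have "T m l \<psi> (T l m \<phi> x) = x" for x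
    using assms \<phi> by (intro TT) (auto simp: \<psi>_def bij_betw_def)
  moreover have "T l m \<phi> (T m l \<psi> x) = x" for x
    using assms \<phi> \<psi> by (intro TT) (auto simp: \<psi>_def bij_betw_def f_inv_into_f)
  ultimately have "bij (T l m \<phi>)"
    by (intro o_bij[of "T m l \<psi>"]) auto
  moreover have "row_shift l \<circ> T l m \<phi> = T l m \<phi> \<circ> row_shift m"
    using assms by (auto simp: T_def row_shift_def algebra_simps)
  ultimately show thesis
    by (rule that) (simp add: T_def)
qed

text \<open>Any intertwiner yields an action in which \<open>a\<close> is
  \<open>row_shift 1\<close>, whose nonzero powers move the origin.\<close>

lemma G_gen_A_pow_neq_one:
  assumes "l \<noteq> 0" "m \<noteq> 0" "z \<noteq> 0"
  shows "G_gen l m A [^]\<^bsub>G_group l m\<^esub> (z :: int) \<noteq> \<one>\<^bsub>G_group l m\<^esub>"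
proof -
  interpret G: group "G_group l m"
    by (rule group_G_group)
  interpret K: group "Bij_group :: (int \<times> nat \<Rightarrow> int \<times> nat) monoid"
    by (rule group_Bij_group)
  obtain \<phi> where "bij_betw \<phi> (row_residues m) (row_residues l)"
    using extend_finite_bij[of "row_residues m" "row_residues l" "{}"]
    by (auto simp: infinite_row_residues)
  from intertwiner[OF assms(2,1) this] obtain \<beta>
    where \<beta>: "bij \<beta>" "row_shift l \<circ> \<beta> = \<beta> \<circ> row_shift m"
    by metis
  obtain h where h: "h \<in> hom (G_group l m) Bij_group" "h (G_gen l m A) = row_shift 1"
    using K.G_group_universal[of "row_shift 1" \<beta> l m] \<beta>
    by (auto simp: bij_row_shift row_shift_pow)
  interpret h: group_hom "G_group l m" "Bij_group :: (int \<times> nat \<Rightarrow> int \<times> nat) monoid" h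
    using h by unfold_locales
  have "h (G_gen l m A [^]\<^bsub>G_group l m\<^esub> z) = row_shift z"
    by (simp add: h.hom_int_pow h row_shift_pow)
  moreover have "row_shift z (0, 0) \<noteq> id (0, 0)"
    using assms by (simp add: row_shift_def)
  ultimately show ?thesis
    using h.hom_one by auto
qed

text \<open>The four prescribed values of \<open>\<phi>\<close> send \<open>\<beta>\<^sup>-\<^sup>1 \<alpha>\<^sup>q \<beta> (0, 0)\<close> to row 1 and
  \<open>\<beta>\<^sup>-\<^sup>1 \<alpha>\<^sup>q \<beta> (1, 0)\<close> to row 2.\<close>

lemma noncommuting_intertwiner:
  assumes "l \<noteq> 0" "m \<noteq> 0" "\<not> l dvd q" "\<not> m dvd 1"
  obtains \<beta> where "bij \<beta>" "row_shift l \<circ> \<beta> = \<beta> \<circ> row_shift m"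
    "\<And>c. \<beta> \<circ> c = row_shift q \<circ> \<beta> \<Longrightarrow> c \<circ> row_shift 1 \<noteq> row_shift 1 \<circ> c"
proof -
  define F :: "(int \<times> nat) set" where "F = {(0, 0), (1 mod m, 0), (0, 1), (0, 2)}"
  define f :: "int \<times> nat \<Rightarrow> int \<times> nat"
    where "f = (\<lambda>_. undefined)((0, 0) := (0, 0), (1 mod m, 0) := (0, 1),
      (0, 1) := (q mod l, 0), (0, 2) := (q mod l, 1))"
  \<comment> \<open>The two nondivisibilities make the four points of \<open>F\<close> distinct, and
    likewise their prescribed values. Outside \<open>F\<close> the map \<open>f\<close> is never
    consulted.\<close>
  have ne: "1 mod m \<noteq> 0" "q mod l \<noteq> 0"
    using assms by (simp_all add: dvd_eq_mod_eq_0)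
  have zero: "0 \<in> range (\<lambda>z. z mod k)" for k :: int
    by (metis mod_0 rangeI)
  have "inj_on f F" "f ` F \<subseteq> row_residues l" "F \<subseteq> row_residues m"
    using ne zero by (auto simp: inj_on_def f_def F_def row_residues_def)
  then obtain \<phi> where \<phi>: "bij_betw \<phi> (row_residues m) (row_residues l)"
      and \<phi>f: "\<And>x. x \<in> F \<Longrightarrow> \<phi> x = f x"
    using extend_finite_bij[of "row_residues m" "row_residues l" F f]
    by (auto simp: infinite_row_residues F_def)
  have vals: "\<phi> (0, 0) = (0, 0)" "\<phi> (1 mod m, 0) = (0, 1)" "\<phi> (0, 1) = (q mod l, 0)"
      "\<phi> (0, 2) = (q mod l, 1)"
    using ne by (simp_all add: \<phi>f F_def) (simp_all add: f_def)
  obtain \<beta> where \<beta>: "bij \<beta>" "row_shift l \<circ> \<beta> = \<beta> \<circ> row_shift m"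
    and \<beta>v: "\<And>z i. \<beta> (z, i) = row_shift (l * (z div m)) (\<phi> (z mod m, i))"
    using intertwiner[OF assms(2,1) \<phi>] by metis
  show thesis
  proof (rule that[OF \<beta>])
    fix c assume c: "\<beta> \<circ> c = row_shift q \<circ> \<beta>"
    then have \<beta>c: "\<beta> (c x) = row_shift q (\<beta> x)" for x
      by (metis comp_apply)
    have "\<beta> (c (0, 0)) = \<beta> (m * (q div l), 1)"
      using assms by (simp add: \<beta>c del: One_nat_def) (simp add: \<beta>v vals row_shift_def del: One_nat_def)
    then have 1: "c (0, 0) = (m * (q div l), 1)"
      using \<beta>(1) by (simp add: bij_is_inj inj_eq)
    have "\<beta> (c (1, 0)) = \<beta> (m * (1 div m + q div l), 2)"
      using assms by (simp add: \<beta>c del: One_nat_def) (simp add: \<beta>v vals row_shift_def algebra_simps del: One_nat_def)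
    then have 2: "c (1, 0) = (m * (1 div m + q div l), 2)"
      using \<beta>(1) by (simp add: bij_is_inj inj_eq)
    show "c \<circ> row_shift 1 \<noteq> row_shift 1 \<circ> c"
    proof
      assume "c \<circ> row_shift 1 = row_shift 1 \<circ> c"
      \<comment> \<open>A shift preserves rows, so commutation would put \<open>c (0, 0)\<close> and
        \<open>c (1, 0)\<close> into the same row.\<close>
      then have "c (row_shift 1 (0, 0)) = row_shift 1 (c (0, 0))"
        by (metis comp_apply)
      then show False
        by (simp add: row_shift_def 1 2)
    qed
  qed
qed

lemma Bij_group_noncommuting:
  assumes "l \<noteq> 0" "m \<noteq> 0" "\<not> l dvd q" "\<not> m dvd 1"
  obtains y where "y \<in> carrier Bij_group" "row_shift l \<circ> y = y \<circ> row_shift m"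
    "inv\<^bsub>Bij_group\<^esub> y \<circ> row_shift q \<circ> y \<circ> row_shift 1 \<noteq>
     row_shift 1 \<circ> (inv\<^bsub>Bij_group\<^esub> y \<circ> row_shift q \<circ> y)"
proof -
  interpret K: group "Bij_group :: (int \<times> nat \<Rightarrow> int \<times> nat) monoid"
    by (rule group_Bij_group)
  obtain y where y: "bij y" "row_shift l \<circ> y = y \<circ> row_shift m"
    "\<And>c. y \<circ> c = row_shift q \<circ> y \<Longrightarrow> c \<circ> row_shift 1 \<noteq> row_shift 1 \<circ> c"
    using noncommuting_intertwiner[OF assms] by metis
  have "y \<circ> (inv\<^bsub>Bij_group\<^esub> y \<circ> row_shift q \<circ> y) = row_shift q \<circ> y"
    using K.r_inv[of y] y(1) by (simp flip: comp_assoc)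
  from y(3)[OF this] show thesis
    by (intro that[OF _ y(2)]) (simp_all add: y(1) comp_assoc)
qed

lemma G_noncommuting:
  assumes "l \<noteq> 0" "m \<noteq> 0" "\<not> l dvd q" "\<not> m dvd 1"
  defines "G \<equiv> G_group l m" and "a \<equiv> G_gen l m A" and "b \<equiv> G_gen l m B"
  shows "inv\<^bsub>G\<^esub> b \<otimes>\<^bsub>G\<^esub> a [^]\<^bsub>G\<^esub> q \<otimes>\<^bsub>G\<^esub> b \<otimes>\<^bsub>G\<^esub> a \<noteq> a \<otimes>\<^bsub>G\<^esub> (inv\<^bsub>G\<^esub> b \<otimes>\<^bsub>G\<^esub> a [^]\<^bsub>G\<^esub> q \<otimes>\<^bsub>G\<^esub> b)"
proof
  assume eq: "inv\<^bsub>G\<^esub> b \<otimes>\<^bsub>G\<^esub> a [^]\<^bsub>G\<^esub> q \<otimes>\<^bsub>G\<^esub> b \<otimes>\<^bsub>G\<^esub> a = a \<otimes>\<^bsub>G\<^esub> (inv\<^bsub>G\<^esub> b \<otimes>\<^bsub>G\<^esub> a [^]\<^bsub>G\<^esub> q \<otimes>\<^bsub>G\<^esub> b)"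
  interpret G: group G
    unfolding G_def by (rule group_G_group)
  interpret K: group "Bij_group :: (int \<times> nat \<Rightarrow> int \<times> nat) monoid"
    by (rule group_Bij_group)
  have ab [simp]: "a \<in> carrier G" "b \<in> carrier G"
    by (simp_all add: G_def a_def b_def)
  obtain y where y: "y \<in> carrier Bij_group" "row_shift l \<circ> y = y \<circ> row_shift m"
    "inv\<^bsub>Bij_group\<^esub> y \<circ> row_shift q \<circ> y \<circ> row_shift 1 \<noteq>
     row_shift 1 \<circ> (inv\<^bsub>Bij_group\<^esub> y \<circ> row_shift q \<circ> y)"
    using Bij_group_noncommuting[OF assms(1-4)] .
  have "row_shift 1 [^]\<^bsub>Bij_group\<^esub> l \<otimes>\<^bsub>Bij_group\<^esub> y = y \<otimes>\<^bsub>Bij_group\<^esub> row_shift 1 [^]\<^bsub>Bij_group\<^esub> m"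
    by (simp add: row_shift_pow y(2))
  then obtain h where h: "h \<in> hom G Bij_group" "h a = row_shift 1" "h b = y"
    using K.G_group_universal[of "row_shift 1" y l m] y(1) bij_row_shift[of 1]
    unfolding G_def a_def b_def fun_group_simps mem_Collect_eq by metis
  interpret h: group_hom G "Bij_group :: (int \<times> nat \<Rightarrow> int \<times> nat) monoid" h
    using h by unfold_locales
  from arg_cong[OF eq, of h] y(3) show False
    by (simp add: h.hom_int_pow h(2,3) row_shift_pow)
qed

text \<open>Inverting \<open>b\<close> exchanges \<open>l\<close> and \<open>m\<close>, so
  \<open>b\<close> now acts as the inverse of an intertwiner for the exchanged pair.\<close>

lemma G_noncommuting':
  assumes "l \<noteq> 0" "m \<noteq> 0" "\<not> m dvd q" "\<not> l dvd 1"
  defines "G \<equiv> G_group l m" and "a \<equiv> G_gen l m A" and "b \<equiv> G_gen l m B"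
  shows "b \<otimes>\<^bsub>G\<^esub> a [^]\<^bsub>G\<^esub> q \<otimes>\<^bsub>G\<^esub> inv\<^bsub>G\<^esub> b \<otimes>\<^bsub>G\<^esub> a \<noteq> a \<otimes>\<^bsub>G\<^esub> (b \<otimes>\<^bsub>G\<^esub> a [^]\<^bsub>G\<^esub> q \<otimes>\<^bsub>G\<^esub> inv\<^bsub>G\<^esub> b)"
proof
  assume eq: "b \<otimes>\<^bsub>G\<^esub> a [^]\<^bsub>G\<^esub> q \<otimes>\<^bsub>G\<^esub> inv\<^bsub>G\<^esub> b \<otimes>\<^bsub>G\<^esub> a = a \<otimes>\<^bsub>G\<^esub> (b \<otimes>\<^bsub>G\<^esub> a [^]\<^bsub>G\<^esub> q \<otimes>\<^bsub>G\<^esub> inv\<^bsub>G\<^esub> b)"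
  interpret G: group G
    unfolding G_def by (rule group_G_group)
  interpret K: group "Bij_group :: (int \<times> nat \<Rightarrow> int \<times> nat) monoid"
    by (rule group_Bij_group)
  have ab [simp]: "a \<in> carrier G" "b \<in> carrier G"
    by (simp_all add: G_def a_def b_def)
  obtain y where y: "y \<in> carrier Bij_group" "row_shift m \<circ> y = y \<circ> row_shift l"
    "inv\<^bsub>Bij_group\<^esub> y \<circ> row_shift q \<circ> y \<circ> row_shift 1 \<noteq>
     row_shift 1 \<circ> (inv\<^bsub>Bij_group\<^esub> y \<circ> row_shift q \<circ> y)"
    using Bij_group_noncommuting[OF assms(2,1,3,4)] .
  have "inv\<^bsub>Bij_group\<^esub> y \<circ> y = id" "y \<circ> inv\<^bsub>Bij_group\<^esub> y = id"
    using K.l_inv[OF y(1)] K.r_inv[OF y(1)] by simp_all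
  note inv_y = this
  have "row_shift l \<circ> inv\<^bsub>Bij_group\<^esub> y = inv\<^bsub>Bij_group\<^esub> y \<circ> (y \<circ> row_shift l) \<circ> inv\<^bsub>Bij_group\<^esub> y"
    by (simp add: inv_y flip: comp_assoc)
  also have "\<dots> = inv\<^bsub>Bij_group\<^esub> y \<circ> row_shift m"
    by (simp add: inv_y comp_assoc flip: y(2))
  finally have "row_shift l \<circ> inv\<^bsub>Bij_group\<^esub> y = inv\<^bsub>Bij_group\<^esub> y \<circ> row_shift m" .
  then have "row_shift 1 [^]\<^bsub>Bij_group\<^esub> l \<otimes>\<^bsub>Bij_group\<^esub> inv\<^bsub>Bij_group\<^esub> y
      = inv\<^bsub>Bij_group\<^esub> y \<otimes>\<^bsub>Bij_group\<^esub> row_shift 1 [^]\<^bsub>Bij_group\<^esub> m"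
    by (simp add: row_shift_pow)
  then obtain h where h: "h \<in> hom G Bij_group" "h a = row_shift 1" "h b = inv\<^bsub>Bij_group\<^esub> y"
    using K.G_group_universal[of "row_shift 1" "inv\<^bsub>Bij_group\<^esub> y" l m] K.inv_closed[OF y(1)] bij_row_shift[of 1]
    unfolding G_def a_def b_def fun_group_simps mem_Collect_eq by metis
  interpret h: group_hom G "Bij_group :: (int \<times> nat \<Rightarrow> int \<times> nat) monoid" h
    using h by unfold_locales
  from arg_cong[OF eq, of h] y(1,3) show False
    by (simp add: h.hom_int_pow h(2,3) row_shift_pow)
qed


section \<open>Necessity\<close>

lemma finite_p_group_pow:
  assumes "finite_p_group p H"
  obtains n where "\<And>x. x \<in> carrier H \<Longrightarrow> x [^]\<^bsub>H\<^esub> (int p ^ n) = \<one>\<^bsub>H\<^esub>"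
proof -
  interpret H: group H
    using assms by (simp add: finite_p_group_def)
  obtain n where n: "order H = p ^ n"
    using assms by (auto simp: finite_p_group_def)
  have "x [^]\<^bsub>H\<^esub> (int p ^ n) = \<one>\<^bsub>H\<^esub>" if "x \<in> carrier H" for x
    using H.pow_order_eq_1[OF that] n by (metis int_pow_int of_nat_power)
  then show thesis
    by (rule that)
qed

lemma (in group) int_pow_eq_one_dvd:
  assumes "x \<in> carrier G" "x [^] (k :: int) = \<one>" "k dvd z"
  shows "x [^] z = \<one>"
  using assms by (auto simp flip: int_pow_pow)

lemma (in group) int_pow_cong:
  assumes "x \<in> carrier G" "x [^] (k :: int) = \<one>" "[y = z] (mod k)"
  shows "x [^] y = x [^] z"
proof -
  have "x [^] (y - z) = \<one>"
    using assms int_pow_eq_one_dvd by (simp add: cong_iff_dvd_diff)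
  with assms show ?thesis
    by (metis int_pow_closed int_pow_diff inv_closed inv_equality inv_inv)
qed

lemma (in group) conj_int_pow:
  assumes "x \<in> carrier G" "y \<in> carrier G"
  shows "inv y \<otimes> x [^] (z :: int) \<otimes> y = (inv y \<otimes> x \<otimes> y) [^] z"
proof -
  have "y \<otimes> (inv y \<otimes> v) = v" if "v \<in> carrier G" for v
    using assms that by (simp flip: m_assoc)
  then have "(\<lambda>x. inv y \<otimes> x \<otimes> y) \<in> hom G G"
    using assms by (intro homI) (simp_all add: m_assoc)
  then interpret c: group_hom G G "\<lambda>x. inv y \<otimes> x \<otimes> y"
    by unfold_locales
  show ?thesis
    using assms by (simp add: c.hom_int_pow)
qed

lemma (in group) conj_pow_iterate:
  assumes xy: "x \<in> carrier G" "y \<in> carrier G" and rel: "inv y \<otimes> x \<otimes> y = x [^] (c :: int)"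
  shows "inv (y [^] n) \<otimes> x \<otimes> y [^] (n :: nat) = x [^] (c ^ n)"
proof (induction n)
  case (Suc n)
  have "inv (y [^] Suc n) \<otimes> x \<otimes> y [^] Suc n = inv y \<otimes> (inv (y [^] n) \<otimes> x \<otimes> y [^] n) \<otimes> y"
    using xy by (simp add: m_assoc inv_mult_group)
  also have "\<dots> = x [^] (c ^ Suc n)"
    using xy by (simp add: Suc conj_int_pow rel int_pow_pow)
  finally show ?case .
qed (use xy in simp)

text \<open>Fermat's little theorem, iterated \<open>n\<close> times. It is proved for natural
  numbers, multiples of \<open>p\<close> included, and carried to the integer \<open>c\<close>
  through its residue.\<close>

lemma fermat_pow:
  fixes c :: int
  assumes "Factorial_Ring.prime p"
  shows "[c ^ (p ^ n) = c] (mod int p)"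
proof (induction n)
  case (Suc n)
  have nat: "[d ^ p = d] (mod p)" for d :: nat
  proof (cases "p dvd d")
    case True
    moreover from this have "p dvd d ^ p"
      using assms by (simp add: dvd_power_iff prime_dvd_power_iff prime_gt_0_nat)
    ultimately show ?thesis
      by (simp add: cong_def dvd_eq_mod_eq_0)
  next
    case False
    then have "[d ^ (p - 1) * d = 1 * d] (mod p)"
      using assms by (intro cong_scalar_right fermat_theorem)
    then show ?thesis
      using assms prime_gt_0_nat power_minus_mult[of p d] by simp
  qed
  define d where "d = nat (c mod int p)"
  have "[int d ^ p = int d] (mod int p)"
    using nat[of d] by (simp flip: cong_int_iff)
  moreover have d: "[c = int d] (mod int p)"
    using assms prime_gt_0_nat by (simp add: d_def)
  ultimately have fermat: "[c ^ p = c] (mod int p)"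
    using cong_trans[OF cong_trans[OF cong_pow[OF d]] cong_sym[OF d]] by blast
  have "[(c ^ p ^ n) ^ p = c ^ p] (mod int p)"
    using Suc by (rule cong_pow)
  then show ?case
    using cong_trans[OF _ fermat] by (simp only: power_Suc2 power_mult)
qed simp

text \<open>Conjugating \<open>p ^ n\<close> times by \<open>y\<close> is trivial, so
  \<open>x\<close> is killed by \<open>c ^ (p ^ n) - 1\<close> as well as by \<open>p ^ n\<close>.
  The former is congruent to \<open>c - 1\<close> modulo \<open>p\<close>, so the two exponents are
  coprime.\<close>

lemma finite_p_group_conj_pow_trivial:
  assumes p: "Factorial_Ring.prime p" and H: "finite_p_group p H"
    and xy: "x \<in> carrier H" "y \<in> carrier H"
    and rel: "inv\<^bsub>H\<^esub> y \<otimes>\<^bsub>H\<^esub> x \<otimes>\<^bsub>H\<^esub> y = x [^]\<^bsub>H\<^esub> c" and c: "\<not> [c = 1] (mod int p)"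
  shows "x = \<one>\<^bsub>H\<^esub>"
proof -
  interpret H: group H
    using H by (simp add: finite_p_group_def)
  obtain n where n: "\<And>z. z \<in> carrier H \<Longrightarrow> z [^]\<^bsub>H\<^esub> (int p ^ n) = \<one>\<^bsub>H\<^esub>"
    using finite_p_group_pow[OF H] by blast
  have "y [^]\<^bsub>H\<^esub> (p ^ n) = \<one>\<^bsub>H\<^esub>"
    using n[OF xy(2)] by (metis int_pow_int of_nat_power)
  with H.conj_pow_iterate[OF xy rel, of "p ^ n"] xy
  have "x [^]\<^bsub>H\<^esub> (c ^ (p ^ n)) = x [^]\<^bsub>H\<^esub> (1 :: int)"
    by simp
  then have 1: "x [^]\<^bsub>H\<^esub> (c ^ (p ^ n) - 1) = \<one>\<^bsub>H\<^esub>"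
    using xy by (simp add: H.int_pow_diff)
  have "\<not> [c ^ (p ^ n) = 1] (mod int p)"
    using c fermat_pow[OF p, of c n] cong_trans cong_sym by blast
  then have "coprime (int p ^ n) (c ^ (p ^ n) - 1)"
    using p by (simp add: cong_iff_dvd_diff prime_imp_coprime)
  then obtain u v where "u * int p ^ n + v * (c ^ (p ^ n) - 1) = 1"
    by (metis bezout_int coprime_imp_gcd_eq_1)
  moreover have "x [^]\<^bsub>H\<^esub> (u * int p ^ n + v * (c ^ (p ^ n) - 1)) = \<one>\<^bsub>H\<^esub>"
    using xy n[OF xy(1)] 1 by (simp add: H.int_pow_mult H.int_pow_eq_one_dvd)
  ultimately show ?thesis
    using xy by (metis H.int_pow_1)
qed

text \<open>In a group of exponent \<open>p\<^sup>n\<close>, \<open>x\<^sup>q\<close> is a power of \<open>x\<^sup>k\<close> when \<open>q\<close> is the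
  \<open>p\<close>-part of \<open>k\<close>.\<close>

lemma (in group) p_part_conj_commute:
  assumes p: "Factorial_Ring.prime p" and x: "x \<in> carrier G" and y: "y \<in> carrier G"
    and n: "x [^] (int p ^ n) = \<one>"
    and q: "k = q * k'" "\<not> int p dvd k'"
    and rel: "inv y \<otimes> x [^] k \<otimes> y = x [^] (j :: int)"
  shows "inv y \<otimes> x [^] q \<otimes> y \<otimes> x = x \<otimes> (inv y \<otimes> x [^] q \<otimes> y)"
proof -
  have "coprime k' (int p ^ n)"
    using p q prime_imp_coprime[of "int p" k'] by (simp add: coprime_commute)
  \<comment> \<open>\<open>u\<close> inverts \<open>k'\<close> modulo the exponent, so
    \<open>k * u\<close> is congruent to \<open>q\<close> and \<open>x [^] q\<close> is a power of
    \<open>x [^] k\<close>. Its conjugate is then a power of \<open>x\<close>.\<close>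
  then obtain u where "[k' * u = 1] (mod int p ^ n)"
    by (metis cong_solve_coprime_int)
  then have "[q * (k' * u) = q * 1] (mod int p ^ n)"
    by (rule cong_scalar_left)
  then have "x [^] q = x [^] (k * u)"
    using x n by (intro int_pow_cong) (auto simp: q(1) mult.assoc cong_sym_eq)
  also have "\<dots> = (x [^] k) [^] u"
    using x by (simp add: int_pow_pow)
  finally have "inv y \<otimes> x [^] q \<otimes> y = (inv y \<otimes> x [^] k \<otimes> y) [^] u"
    using x y by (simp only: conj_int_pow int_pow_closed)
  then have "inv y \<otimes> x [^] q \<otimes> y = x [^] (j * u)"
    using x by (simp add: rel int_pow_pow)
  then show ?thesis
    using x by (metis add.commute int_pow_1 int_pow_mult)
qed

section \<open>Transfer of identities from finite \<open>p\<close>-quotients to the group\<close>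

lemma residually_finite_p_eq_one:
  assumes "residually_finite_p p G" "g \<in> carrier G"
    and "\<And>(H :: nat monoid) h. finite_p_group p H \<Longrightarrow> h \<in> hom G H \<Longrightarrow> h g = \<one>\<^bsub>H\<^esub>"
  shows "g = \<one>\<^bsub>G\<^esub>"
  using assms unfolding residually_finite_p_def epi_def by blast

lemma residually_finite_p_eq:
  assumes "residually_finite_p p G" "group G" "g \<in> carrier G" "g' \<in> carrier G"
    and "\<And>(H :: nat monoid) h. finite_p_group p H \<Longrightarrow> h \<in> hom G H \<Longrightarrow> h g = h g'"
  shows "g = g'"
proof -
  interpret G: group G
    by fact
  have "g \<otimes>\<^bsub>G\<^esub> inv\<^bsub>G\<^esub> g' = \<one>\<^bsub>G\<^esub>"
  proof (rule residually_finite_p_eq_one[OF assms(1)])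
    fix H :: "nat monoid" and h
    assume H: "finite_p_group p H" "h \<in> hom G H"
    then interpret h: group_hom G H h
      using G.is_group by (simp add: finite_p_group_def group_hom_def group_hom_axioms_def)
    show "h (g \<otimes>\<^bsub>G\<^esub> inv\<^bsub>G\<^esub> g') = \<one>\<^bsub>H\<^esub>"
      using assms(3,4) by (simp add: assms(5)[OF H])
  qed (use assms in auto)
  then show ?thesis
    using assms(3,4) by (simp add: G.inv_solve_right')
qed

text \<open>In a finite \<open>p\<close>-quotient \<open>b\<close> conjugates the image of a^l to
  its \<open>c\<close>-th power, which kills it unless \<open>c\<close> is 1 modulo
  \<open>p\<close>; but \<open>a\<close> has infinite order.\<close>

lemma residually_finite_p_ratio:
  assumes p: "Factorial_Ring.prime p" and res: "residually_finite_p p (G_group l m)"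
    and "l \<noteq> 0" "m \<noteq> 0" "m = l * c"
  shows "[c = 1] (mod int p)"
proof (rule ccontr)
  assume c: "\<not> [c = 1] (mod int p)"
  define G a b where "G = G_group l m" and "a = G_gen l m A" and "b = G_gen l m B"
  interpret G: group G
    unfolding G_def by (rule group_G_group)
  have ab: "a \<in> carrier G" "b \<in> carrier G"
    by (simp_all add: a_def b_def G_def)
  have "a [^]\<^bsub>G\<^esub> l = \<one>\<^bsub>G\<^esub>"
  proof (rule residually_finite_p_eq_one)
    fix H :: "nat monoid" and h
    assume H: "finite_p_group p H" "h \<in> hom G H"
    then interpret h: group_hom G H h
      by (simp add: finite_p_group_def group_hom_def group_hom_axioms_def)
    have "inv\<^bsub>G\<^esub> b \<otimes>\<^bsub>G\<^esub> a [^]\<^bsub>G\<^esub> l \<otimes>\<^bsub>G\<^esub> b = a [^]\<^bsub>G\<^esub> m"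
      using G_gen_relation by (simp add: G_def a_def b_def)
    then have "h (inv\<^bsub>G\<^esub> b \<otimes>\<^bsub>G\<^esub> a [^]\<^bsub>G\<^esub> l \<otimes>\<^bsub>G\<^esub> b) = h (a [^]\<^bsub>G\<^esub> m)"
      by simp
    then have "inv\<^bsub>H\<^esub> h b \<otimes>\<^bsub>H\<^esub> h a [^]\<^bsub>H\<^esub> l \<otimes>\<^bsub>H\<^esub> h b = (h a [^]\<^bsub>H\<^esub> l) [^]\<^bsub>H\<^esub> c"
      using ab by (simp add: h.hom_int_pow h.H.int_pow_pow assms(5))
    then show "h (a [^]\<^bsub>G\<^esub> l) = \<one>\<^bsub>H\<^esub>"
      using finite_p_group_conj_pow_trivial[OF p H(1) _ _ _ c, of "h a [^]\<^bsub>H\<^esub> l" "h b"] ab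
      by (simp add: h.hom_int_pow)
  qed (use res ab in \<open>simp_all flip: G_def\<close>)
  with G_gen_A_pow_neq_one[of l m l] assms show False
    by (simp add: G_def a_def)
qed

text \<open>In each finite \<open>p\<close>-quotient the conjugate of a^q by \<open>b\<close>
  commutes with \<open>a\<close>. Residual finiteness lifts this to the group, where
  \<open>G_noncommuting\<close> leaves only \<open>l dvd q\<close>. The second claim uses the
  inverse of \<open>b\<close> instead.\<close>

lemma residually_finite_p_dvd:
  fixes l m :: int
  assumes p: "Factorial_Ring.prime p" and res: "residually_finite_p p (G_group l m)"
    and "l \<noteq> 0" "m \<noteq> 0"
  shows "\<not> m dvd 1 \<Longrightarrow> l = q * l' \<Longrightarrow> \<not> int p dvd l' \<Longrightarrow> l dvd q"
    and "\<not> l dvd 1 \<Longrightarrow> m = q * m' \<Longrightarrow> \<not> int p dvd m' \<Longrightarrow> m dvd q"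
proof -
  define G a b where "G = G_group l m" and "a = G_gen l m A" and "b = G_gen l m B"
  interpret G: group G
    unfolding G_def by (rule group_G_group)
  have ab [simp]: "a \<in> carrier G" "b \<in> carrier G"
    by (simp_all add: a_def b_def G_def)
  have rel: "inv\<^bsub>G\<^esub> b \<otimes>\<^bsub>G\<^esub> a [^]\<^bsub>G\<^esub> l \<otimes>\<^bsub>G\<^esub> b = a [^]\<^bsub>G\<^esub> m"
    using G_gen_relation by (simp add: G_def a_def b_def)
  have "b \<otimes>\<^bsub>G\<^esub> (inv\<^bsub>G\<^esub> b \<otimes>\<^bsub>G\<^esub> a [^]\<^bsub>G\<^esub> l) = a [^]\<^bsub>G\<^esub> l"
    by (simp flip: G.m_assoc)
  then have rel': "inv\<^bsub>G\<^esub> (inv\<^bsub>G\<^esub> b) \<otimes>\<^bsub>G\<^esub> a [^]\<^bsub>G\<^esub> m \<otimes>\<^bsub>G\<^esub> inv\<^bsub>G\<^esub> b = a [^]\<^bsub>G\<^esub> l"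
    by (simp add: G.m_assoc flip: rel)
  have comm: "inv\<^bsub>G\<^esub> y \<otimes>\<^bsub>G\<^esub> a [^]\<^bsub>G\<^esub> q \<otimes>\<^bsub>G\<^esub> y \<otimes>\<^bsub>G\<^esub> a = a \<otimes>\<^bsub>G\<^esub> (inv\<^bsub>G\<^esub> y \<otimes>\<^bsub>G\<^esub> a [^]\<^bsub>G\<^esub> q \<otimes>\<^bsub>G\<^esub> y)"
    if y: "y \<in> carrier G" "inv\<^bsub>G\<^esub> y \<otimes>\<^bsub>G\<^esub> a [^]\<^bsub>G\<^esub> k \<otimes>\<^bsub>G\<^esub> y = a [^]\<^bsub>G\<^esub> j"
      and k: "k = q * k'" "\<not> int p dvd k'" for y and k j q k' :: int
  proof (rule residually_finite_p_eq)
    fix H :: "nat monoid" and h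
    assume H: "finite_p_group p H" "h \<in> hom G H"
    then interpret h: group_hom G H h
      by (simp add: finite_p_group_def group_hom_def group_hom_axioms_def)
    obtain n where n: "\<And>x. x \<in> carrier H \<Longrightarrow> x [^]\<^bsub>H\<^esub> (int p ^ n) = \<one>\<^bsub>H\<^esub>"
      using finite_p_group_pow[OF H(1)] by blast
    have "h (inv\<^bsub>G\<^esub> y \<otimes>\<^bsub>G\<^esub> a [^]\<^bsub>G\<^esub> k \<otimes>\<^bsub>G\<^esub> y) = h (a [^]\<^bsub>G\<^esub> j)"
      by (simp add: y(2))
    then have "inv\<^bsub>H\<^esub> h y \<otimes>\<^bsub>H\<^esub> h a [^]\<^bsub>H\<^esub> k \<otimes>\<^bsub>H\<^esub> h y = h a [^]\<^bsub>H\<^esub> j"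
      using y(1) by (simp add: h.hom_int_pow)
    from h.H.p_part_conj_commute[OF p _ _ n k this]
    show "h (inv\<^bsub>G\<^esub> y \<otimes>\<^bsub>G\<^esub> a [^]\<^bsub>G\<^esub> q \<otimes>\<^bsub>G\<^esub> y \<otimes>\<^bsub>G\<^esub> a) = h (a \<otimes>\<^bsub>G\<^esub> (inv\<^bsub>G\<^esub> y \<otimes>\<^bsub>G\<^esub> a [^]\<^bsub>G\<^esub> q \<otimes>\<^bsub>G\<^esub> y))"
      using y(1) by (simp add: h.hom_int_pow)
  qed (use res y G.is_group in \<open>simp_all flip: G_def\<close>)
  show "l dvd q" if nu: "\<not> m dvd 1" and q: "l = q * l'" "\<not> int p dvd l'"
  proof (rule ccontr)
    assume "\<not> l dvd q"
    from G_noncommuting[OF assms(3,4) this nu] comm[OF ab(2) rel q] show False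
      unfolding G_def a_def b_def by (rule notE)
  qed
  show "m dvd q" if nu: "\<not> l dvd 1" and q: "m = q * m'" "\<not> int p dvd m'"
  proof (rule ccontr)
    assume "\<not> m dvd q"
    note G_noncommuting'[OF assms(3,4) this nu]
    moreover have "b \<otimes>\<^bsub>G\<^esub> a [^]\<^bsub>G\<^esub> q \<otimes>\<^bsub>G\<^esub> inv\<^bsub>G\<^esub> b \<otimes>\<^bsub>G\<^esub> a = a \<otimes>\<^bsub>G\<^esub> (b \<otimes>\<^bsub>G\<^esub> a [^]\<^bsub>G\<^esub> q \<otimes>\<^bsub>G\<^esub> inv\<^bsub>G\<^esub> b)"
      using comm[OF G.inv_closed[OF ab(2)] rel' q] by simp
    ultimately show False
      unfolding G_def a_def b_def by (rule notE)
  qed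
qed

lemma int_p_part:
  fixes k :: int
  assumes "Factorial_Ring.prime p" "k \<noteq> 0"
  obtains r k' where "k = int p ^ r * k'" "\<not> int p dvd k'"
  using assms multiplicity_decompose'[of k "int p"]
  by (metis mult.commute prime_int_nat_transfer not_prime_unit prime_nat_int_transfer)

lemma residually_finite_p_necessary:
  fixes p :: nat and l m :: int
  assumes p: "Factorial_Ring.prime p" and lm: "\<bar>m\<bar> \<ge> l" "l > 0"
    and res: "residually_finite_p p (G_group l m)"
  shows "(l = 1 \<and> [m = 1] (mod int p)) \<or>
    (\<bar>m\<bar> = l \<and> (\<exists>r :: nat. l = int p ^ r) \<and> (m = - l \<longrightarrow> p = 2))"
proof (cases "l = 1")
  case True
  then show ?thesis
    using residually_finite_p_ratio[OF p res, of m] lm by auto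
next
  case False
  have nz: "l \<noteq> 0" "m \<noteq> 0"
    using lm by auto
  \<comment> \<open>For \<open>l > 1\<close> neither \<open>l\<close> nor \<open>m\<close> is a
    unit, so both divisibility criteria apply and show that each is, up to sign, its own
    \<open>p\<close>-part.\<close>
  have nu: "\<not> l dvd 1" "\<not> m dvd 1"
    using lm False by auto
  have p1: "int p > 1"
    using p prime_gt_1_nat by simp
  obtain r l' where l': "l = int p ^ r * l'" "\<not> int p dvd l'"
    using int_p_part[OF p nz(1)] .
  have "l dvd int p ^ r"
    by (rule residually_finite_p_dvd(1)[OF p res nz nu(2) l'])
  then have l: "l = int p ^ r"
    using l'(1) lm p1 by (intro zdvd_antisym_nonneg) auto
  obtain t m' where m': "m = int p ^ t * m'" "\<not> int p dvd m'"
    using int_p_part[OF p nz(2)] .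
  have "m dvd int p ^ t"
    by (rule residually_finite_p_dvd(2)[OF p res nz nu(1) m'])
  then have "\<bar>m\<bar> = \<bar>int p ^ t\<bar>"
    using m'(1) by (intro zdvd_antisym_abs) auto
  then have m: "\<bar>m\<bar> = int p ^ t"
    by simp
  have rt: "r \<le> t"
    using lm(1) p1 unfolding l m by simp
  \<comment> \<open>The quotient of \<open>m\<close> by \<open>l\<close>. Being 1 modulo
    \<open>p\<close>, it has no factor \<open>p\<close>, and it can be -1 only for
    \<open>p = 2\<close>.\<close>
  define c where "c = sgn m * int p ^ (t - r)"
  have "m = sgn m * int p ^ t"
    by (metis m mult_sgn_abs)
  moreover have "int p ^ t = int p ^ r * int p ^ (t - r)"
    using rt by (simp flip: power_add)
  ultimately have "m = l * c"
    by (simp add: l c_def mult.left_commute)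
  then have c: "[c = 1] (mod int p)"
    using residually_finite_p_ratio[OF p res nz] by blast
  have "t = r"
  proof (rule ccontr)
    assume "t \<noteq> r"
    with rt have "int p dvd c"
      by (simp add: c_def dvd_power)
    then have "int p dvd 1"
      using c by (meson cong_dvd_iff)
    with p1 show False
      by simp
  qed
  moreover have "p = 2" if "m = - l"
  proof -
    have "c = -1"
      using \<open>m = l * c\<close> that nz by (metis mult_cancel_left mult_minus1_right)
    then have "int p dvd 2"
      using c by (simp add: cong_iff_dvd_diff)
    then show "p = 2"
      using p1 by (auto dest: zdvd_imp_le)
  qed
  ultimately show ?thesis
    using l m by auto
qed


section \<open>Finite \<open>p\<close>-groups of permutations\<close>

text \<open>Sylow's theorem with exponent 1 turns another prime divisor \<open>q\<close> of the
  order into a subgroup of order \<open>q\<close>; the order of its elements divides both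
  \<open>q\<close> and \<open>p ^ n\<close>.\<close>

lemma finite_p_groupI:
  assumes p: "Factorial_Ring.prime p" and G: "group G" "finite (carrier G)"
    and exp: "\<And>x. x \<in> carrier G \<Longrightarrow> x [^]\<^bsub>G\<^esub> (p ^ n :: nat) = \<one>\<^bsub>G\<^esub>"
  shows "finite_p_group p G"
proof -
  interpret G: group G
    by fact
  have pos: "order G \<noteq> 0"
    using G by (simp add: order_def card_gt_0_iff G.carrier_not_empty)
  have "q = p" if q: "Factorial_Ring.prime q" "q dvd order G" for q
  proof (rule ccontr)
    assume "q \<noteq> p"
    with p q have cop: "coprime q (p ^ n)"
      by (metis coprime_power_right_iff primes_coprime)
    obtain k where "order G = q ^ 1 * k"
      using q(2) unfolding dvd_def power_one_right by blast
    from sylow_thm[OF q(1) G(1) this G(2)] obtain Q where Q: "subgroup Q G" "card Q = q"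
      by auto
    have "\<not> Q \<subseteq> {\<one>\<^bsub>G\<^esub>}"
    proof
      assume "Q \<subseteq> {\<one>\<^bsub>G\<^esub>}"
      then have "card Q \<le> 1"
        using card_mono[of "{\<one>\<^bsub>G\<^esub>}" Q] by simp
      with Q(2) prime_gt_1_nat[OF q(1)] show False
        by simp
    qed
    then obtain x where x: "x \<in> Q" "x \<noteq> \<one>\<^bsub>G\<^esub>"
      by auto
    have xG: "x \<in> carrier G"
      by (rule subgroup.mem_carrier[OF Q(1) x(1)])
    interpret Q: group "G\<lparr>carrier := Q\<rparr>"
      by (rule G.subgroup_imp_group[OF Q(1)])
    have "x [^]\<^bsub>G\<lparr>carrier := Q\<rparr>\<^esub> q = \<one>\<^bsub>G\<^esub>"
      using Q.pow_order_eq_1[of x] x(1) Q(2) by (simp add: order_def)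
    then have "x [^]\<^bsub>G\<^esub> q = \<one>\<^bsub>G\<^esub>"
      by (simp flip: G.nat_pow_consistent)
    then have "G.ord x dvd q" "G.ord x dvd p ^ n"
      using exp[OF xG] xG by (simp_all add: G.pow_eq_id)
    with cop have "G.ord x = 1"
      by (metis coprime_common_divisor_nat nat_dvd_1_iff_1)
    then show False
      using x(2) xG G.ord_eq_1 by blast
  qed
  then have "prime_factors (order G) \<subseteq> {p}"
    by (auto simp: prime_factors_dvd)
  then have "prime_factors (order G) = {} \<or> prime_factors (order G) = {p}"
    by (rule subset_singletonD)
  moreover have "order G = (\<Prod>q\<in>prime_factors (order G). q ^ multiplicity q (order G))"
    using pos by (simp add: prod_prime_factors)
  ultimately have "order G = p ^ 0 \<or> order G = p ^ multiplicity p (order G)"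
    by fastforce
  then have "\<exists>k. order G = p ^ k"
    by blast
  with G show ?thesis
    by (simp add: finite_p_group_def)
qed

text \<open>The image of \<open>k\<close> is isomorphic to a subgroup of a finite
  \<open>p\<close>-group, so its order is a power of \<open>p\<close> by Lagrange. It is thus enough
  to find homomorphisms, onto or not, into finite \<open>p\<close>-groups over any type.\<close>

lemma separating_homI:
  fixes K :: "('c, 'd) monoid_scheme"
  assumes G: "group G" and K: "finite_p_group p K" and p: "Factorial_Ring.prime p"
    and k: "k \<in> hom G K" "g \<in> carrier G" "k g \<noteq> \<one>\<^bsub>K\<^esub>"
  shows "\<exists>(H :: nat monoid) h. finite_p_group p H \<and> h \<in> epi G H \<and> h g \<noteq> \<one>\<^bsub>H\<^esub>"
proof -
  obtain H :: "nat monoid" and f where H: "finite_p_group p H" "f \<in> iso K H"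
    using finite_p_group_nat_copy[OF K] .
  interpret H: group H
    using H(1) by (simp add: finite_p_group_def)
  interpret K: group K
    using K by (simp add: finite_p_group_def)
  have f: "f \<in> hom K H" "inj_on f (carrier K)"
    using H(2) by (auto simp: iso_def bij_betw_def)
  have hom: "f \<circ> k \<in> hom G H"
    using k(1) f(1) by (rule Group.hom_compose)
  then interpret h: group_hom G H "f \<circ> k"
    using G H.is_group by (simp add: group_hom_def group_hom_axioms_def)
  let ?I = "(f \<circ> k) ` carrier G"
  have I: "subgroup ?I H"
    by (rule h.img_is_subgroup)
  have "card ?I dvd order H"
    using H.lagrange[OF I] by (metis dvd_triv_right)
  with H(1) p have "\<exists>n. card ?I = p ^ n"
    by (metis divides_primepow_nat finite_p_group_def)
  moreover have "finite ?I"
    using H(1) subgroup.subset[OF I] finite_subset by (auto simp: finite_p_group_def)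
  ultimately have "finite_p_group p (H\<lparr>carrier := ?I\<rparr>)"
    using H.subgroup_imp_group[OF I] by (simp add: finite_p_group_def order_def)
  moreover have "f \<circ> k \<in> epi G (H\<lparr>carrier := ?I\<rparr>)"
    using hom by (auto simp: epi_def hom_def)
  moreover have "(f \<circ> k) g \<noteq> \<one>\<^bsub>H\<lparr>carrier := ?I\<rparr>\<^esub>"
  proof
    assume "(f \<circ> k) g = \<one>\<^bsub>H\<lparr>carrier := ?I\<rparr>\<^esub>"
    then have "f (k g) = f \<one>\<^bsub>K\<^esub>"
      using hom_one[OF f(1) K.is_group H.is_group] by simp
    then have "k g = \<one>\<^bsub>K\<^esub>"
      using f(2) k(1,2) by (meson K.one_closed hom_in_carrier inj_onD)
    with k(3) show False ..
  qed
  ultimately show ?thesis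
    by blast
qed

text \<open>The permutations below respect a chain of equivalence relations on \<open>S\<close>, the \<open>i\<close>-th of which
  is \<open>agree i\<close>; each \<open>agree i\<close>-class is cut by \<open>\<delta> i\<close> into at most \<open>p\<close> classes of \<open>agree (i + 1)\<close>,
  and these are permuted like translations of \<open>\<int>/p\<int>\<close>.\<close>

locale p_chain =
  fixes p :: nat and S :: "'x set" and D :: nat and \<delta> :: "nat \<Rightarrow> 'x \<Rightarrow> 'x \<Rightarrow> int"
  assumes prime_p: "Factorial_Ring.prime p" and finite_S: "finite S"
    and cocycle_ax: "\<And>i x y z. \<lbrakk>i < D; x \<in> S; y \<in> S; z \<in> S;
      \<forall>k<i. int p dvd \<delta> k x y; \<forall>k<i. int p dvd \<delta> k y z\<rbrakk> \<Longrightarrow>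
      [\<delta> i x z = \<delta> i x y + \<delta> i y z] (mod int p)"
    and separate_ax: "\<And>x y. \<lbrakk>x \<in> S; y \<in> S; \<forall>k<D. int p dvd \<delta> k x y\<rbrakk> \<Longrightarrow> x = y"
begin

definition agree :: "nat \<Rightarrow> 'x \<Rightarrow> 'x \<Rightarrow> bool" where
  "agree i x y \<longleftrightarrow> (\<forall>k<i. int p dvd \<delta> k x y)"

lemmas cocycle = cocycle_ax[folded agree_def]
  and separate = separate_ax[folded agree_def]

definition chain_perms :: "('x \<Rightarrow> 'x) set" where
  "chain_perms = {f. f permutes S \<and>
     (\<forall>x\<in>S. \<forall>y\<in>S. \<forall>i<D. agree i x y \<longrightarrow> [\<delta> i (f x) (f y) = \<delta> i x y] (mod int p))}"

lemma agree_Suc: "agree (Suc i) x y \<longleftrightarrow> agree i x y \<and> int p dvd \<delta> i x y"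
  by (auto simp: agree_def less_Suc_eq)

lemma agree_0 [simp]: "agree 0 x y"
  by (simp add: agree_def)

lemma agree_refl: "x \<in> S \<Longrightarrow> i \<le> D \<Longrightarrow> agree i x x"
proof (induction i)
  case (Suc i)
  \<comment> \<open>At the triple \<open>x\<close>, \<open>x\<close>, \<open>x\<close> the cocycle
    rule reads d = d + d, so d vanishes modulo \<open>p\<close>.\<close>
  then have "[\<delta> i x x = \<delta> i x x + \<delta> i x x] (mod int p)"
    by (intro cocycle) auto
  with Suc show ?case
    by (simp add: agree_Suc cong_iff_dvd_diff)
qed simp

lemma agree_trans:
  "\<lbrakk>x \<in> S; y \<in> S; z \<in> S; i \<le> D; agree i x y; agree i y z\<rbrakk> \<Longrightarrow> agree i x z"
proof (induction i)
  case (Suc i)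
  then have "[\<delta> i x z = \<delta> i x y + \<delta> i y z] (mod int p)"
    by (intro cocycle) (auto simp: agree_Suc)
  with Suc show ?case
    by (auto simp: agree_Suc cong_dvd_iff)
qed simp

lemma preserves_agree:
  assumes "\<And>i. i < D \<Longrightarrow> agree i x y \<Longrightarrow> [\<delta> i (f x) (f y) = \<delta> i x y] (mod int p)"
  shows "i \<le> D \<Longrightarrow> agree i (f x) (f y) \<longleftrightarrow> agree i x y"
proof (induction i)
  case (Suc i)
  then show ?case
    using assms[of i] by (auto simp: agree_Suc cong_dvd_iff)
qed simp

text \<open>Preserving the differences reflects agreement, so points with equal images agree up to
  level \<open>D\<close> and coincide. Finiteness of \<open>S\<close> then gives
  surjectivity.\<close>

lemma chain_permsI:
  assumes f: "\<And>x. x \<in> S \<Longrightarrow> f x \<in> S" "\<And>x. x \<notin> S \<Longrightarrow> f x = x"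
    and \<delta>: "\<And>i x y. \<lbrakk>i < D; x \<in> S; y \<in> S; agree i x y\<rbrakk> \<Longrightarrow> [\<delta> i (f x) (f y) = \<delta> i x y] (mod int p)"
  shows "f \<in> chain_perms"
proof -
  have "inj_on f S"
  proof (rule inj_onI)
    fix x y assume xy: "x \<in> S" "y \<in> S" "f x = f y"
    then have "agree D (f x) (f y)"
      by (simp add: agree_refl f)
    then have "agree D x y"
      using preserves_agree[of x y f D] \<delta> xy by blast
    with xy show "x = y"
      by (simp add: separate)
  qed
  then have "bij_betw f S S"
    using f(1) finite_S by (simp add: bij_betw_def endo_inj_surj image_subsetI)
  then have "f permutes S"
    using f(2) by (rule bij_imp_permutes)
  with \<delta> show ?thesis
    by (simp add: chain_perms_def)
qed

lemma chain_perms_closed: "f \<in> chain_perms \<Longrightarrow> x \<in> S \<Longrightarrow> f x \<in> S"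
  by (simp add: chain_perms_def permutes_in_image)

lemma chain_perms_agree:
  assumes "f \<in> chain_perms" "x \<in> S" "y \<in> S" "i \<le> D"
  shows "agree i (f x) (f y) \<longleftrightarrow> agree i x y"
  using preserves_agree[of x y f i] assms by (auto simp: chain_perms_def)

lemma id_chain_perms: "id \<in> chain_perms"
  by (simp add: chain_perms_def permutes_id)

lemma comp_chain_perms:
  assumes f: "f \<in> chain_perms" and g: "g \<in> chain_perms"
  shows "f \<circ> g \<in> chain_perms"
proof (rule chain_permsI)
  fix i x y assume ixy: "i < D" "x \<in> S" "y \<in> S" "agree i x y"
  then have "[\<delta> i (f (g x)) (f (g y)) = \<delta> i (g x) (g y)] (mod int p)"
    using f g chain_perms_agree[OF g, of x y i] chain_perms_closed[OF g]
    by (auto simp: chain_perms_def)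
  moreover have "[\<delta> i (g x) (g y) = \<delta> i x y] (mod int p)"
    using g ixy by (auto simp: chain_perms_def)
  ultimately show "[\<delta> i ((f \<circ> g) x) ((f \<circ> g) y) = \<delta> i x y] (mod int p)"
    using cong_trans by fastforce
qed (use assms chain_perms_closed in \<open>auto simp: chain_perms_def permutes_def\<close>)

lemma funpow_chain_perms: "f \<in> chain_perms \<Longrightarrow> f ^^ n \<in> chain_perms"
  by (induction n) (simp_all add: id_chain_perms comp_chain_perms)

text \<open>If \<open>g\<close> fixes the \<open>agree i\<close>-class of \<open>x\<close>, it
  shifts the coordinate \<open>\<delta> i\<close> there by a constant, so \<open>n\<close> steps
  shift it by \<open>n\<close> times that constant.\<close>

lemma funpow_agree:
  assumes g: "g \<in> chain_perms" and x: "x \<in> S" and i: "i < D" and ag: "agree i (g x) x"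
  shows "agree i ((g ^^ n) x) x \<and> [\<delta> i ((g ^^ n) x) x = int n * \<delta> i (g x) x] (mod int p)"
proof (induction n)
  case 0
  have "agree (Suc i) x x"
    using x i by (intro agree_refl) auto
  then show ?case
    by (simp add: agree_Suc cong_0_iff)
next
  case (Suc n)
  let ?y = "(g ^^ n) x"
  have y: "?y \<in> S" "g x \<in> S" "g ?y \<in> S"
    using x g by (auto intro: chain_perms_closed funpow_chain_perms)
  have 1: "agree i (g ?y) (g x)"
    using chain_perms_agree[OF g y(1) x] Suc i by simp
  have "[\<delta> i (g ?y) x = \<delta> i (g ?y) (g x) + \<delta> i (g x) x] (mod int p)"
    using i x y 1 ag by (intro cocycle) auto
  moreover have "[\<delta> i (g ?y) (g x) = \<delta> i ?y x] (mod int p)"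
    using g x y i Suc by (auto simp: chain_perms_def)
  ultimately have "[\<delta> i (g ?y) x = int n * \<delta> i (g x) x + \<delta> i (g x) x] (mod int p)"
    using Suc by (meson cong_add cong_refl cong_trans)
  moreover have "agree i (g ?y) x"
    using i x y 1 ag by (intro agree_trans[of "g ?y" "g x" x]) auto
  ultimately show ?case
    by (simp add: algebra_simps)
qed

text \<open>Once \<open>f ^^ (p ^ i)\<close> fixes all classes of level \<open>i\<close>, it
  translates their subclasses modulo \<open>p\<close>, so its \<open>p\<close>-th power fixes those
  of level \<open>i + 1\<close>.\<close>

lemma funpow_prime_power_agree:
  assumes f: "f \<in> chain_perms"
  shows "i \<le> D \<Longrightarrow> x \<in> S \<Longrightarrow> agree i ((f ^^ (p ^ i)) x) x"
proof (induction i)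
  case (Suc i)
  let ?g = "f ^^ (p ^ i)"
  have "agree i ((?g ^^ p) x) x \<and> [\<delta> i ((?g ^^ p) x) x = int p * \<delta> i (?g x) x] (mod int p)"
    using Suc by (intro funpow_agree funpow_chain_perms[OF f]) auto
  moreover have "?g ^^ p = f ^^ (p ^ Suc i)"
    by (simp add: funpow_mult mult.commute)
  ultimately show ?case
    unfolding agree_Suc by (metis cong_dvd_iff dvd_triv_left)
qed simp

lemma funpow_prime_power_id:
  assumes f: "f \<in> chain_perms"
  shows "f ^^ (p ^ D) = id"
proof
  fix x
  have g: "f ^^ (p ^ D) \<in> chain_perms"
    by (rule funpow_chain_perms[OF f])
  show "(f ^^ (p ^ D)) x = id x"
  proof (cases "x \<in> S")
    case True
    then show ?thesis
      using funpow_prime_power_agree[OF f, of D x] separate[of _ x] chain_perms_closed[OF g] by simp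
  next
    case False
    with g show ?thesis
      by (simp add: chain_perms_def permutes_def)
  qed
qed

lemma group_chain_perms: "group (fun_group chain_perms)"
proof (rule group_fun_group)
  fix f assume f: "f \<in> chain_perms"
  \<comment> \<open>The inverse of \<open>f\<close> is a power of \<open>f\<close>, hence stays in
    \<open>chain_perms\<close>.\<close>
  have "f ^^ (p ^ D - 1) \<circ> f = f ^^ (p ^ D)"
    using prime_p prime_gt_0_nat by (simp flip: funpow_Suc_right del: funpow.simps)
  then show "\<exists>g\<in>chain_perms. g \<circ> f = id"
    using f by (metis funpow_chain_perms funpow_prime_power_id)
qed (auto intro: id_chain_perms comp_chain_perms)

lemma finite_p_group_chain_perms: "finite_p_group p (fun_group chain_perms)"
proof (rule finite_p_groupI[where n = D, OF prime_p group_chain_perms])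
  show "finite (carrier (fun_group chain_perms))"
    by (rule finite_subset[OF _ finite_permutations[OF finite_S]]) (auto simp: chain_perms_def)
qed (simp add: fun_group_nat_pow funpow_prime_power_id)

end


section \<open>Affine quotients\<close>

locale affine_chain =
  fixes p n :: nat
  assumes prime: "Factorial_Ring.prime p"
begin

abbreviation q :: int where "q \<equiv> int p ^ n"

text \<open>For \<open>x\<close> and \<open>y\<close> congruent modulo \<open>int p ^ i\<close> the
  division is exact, and modulo \<open>p\<close> it gives the difference of the \<open>i\<close>-th
  digits in base \<open>p\<close>.\<close>

abbreviation digit_diff :: "nat \<Rightarrow> int \<Rightarrow> int \<Rightarrow> int" where
  "digit_diff i x y \<equiv> (x - y) div int p ^ i"

lemma p_pos: "int p > 0"
  using prime prime_gt_0_nat by simp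

lemma digits_agree_iff: "(\<forall>k<i. int p dvd digit_diff k x y) \<longleftrightarrow> int p ^ i dvd x - y"
proof (induction i)
  case (Suc i)
  have "int p ^ Suc i dvd d \<longleftrightarrow> int p ^ i dvd d \<and> int p dvd d div int p ^ i" for d
  proof (cases "int p ^ i dvd d")
    case True
    then obtain e where "d = int p ^ i * e" ..
    with p_pos show ?thesis
      by (simp add: mult.commute[of "int p"])
  next
    case False
    then show ?thesis
      by (metis dvd_trans le_imp_power_dvd lessI less_imp_le)
  qed
  with Suc show ?case
    by (auto simp: less_Suc_eq)
qed simp

sublocale p_chain p "{0..<q}" n digit_diff
proof
  fix i x y z
  assume "\<forall>k<i. int p dvd digit_diff k x y"
  then have "int p ^ i dvd x - y"
    by (simp add: digits_agree_iff)
  then have "(x - y + (y - z)) div int p ^ i = digit_diff i x y + digit_diff i y z"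
    by (rule div_plus_div_distrib_dvd_left)
  then show "[digit_diff i x z = digit_diff i x y + digit_diff i y z] (mod int p)"
    by simp
next
  fix x y
  assume "x \<in> {0..<q}" "y \<in> {0..<q}" "\<forall>k<n. int p dvd digit_diff k x y"
  then show "x = y"
    by (simp add: digits_agree_iff mod_eq_dvd_iff[symmetric])
qed (simp_all add: prime)

definition affine :: "int \<Rightarrow> int \<Rightarrow> int \<Rightarrow> int" where
  "affine u c x = (if x \<in> {0..<q} then (u * x + c) mod q else x)"

lemma affine_closed: "x \<in> {0..<q} \<Longrightarrow> affine u c x \<in> {0..<q}"
  using p_pos by (simp add: affine_def)

lemma affine_comp: "affine u c \<circ> affine v d = affine (u * v) (u * d + c)"
proof
  fix x
  have "(u * ((v * x + d) mod q) + c) mod q = (u * (v * x + d) + c) mod q"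
    by (metis mod_add_left_eq mod_mult_right_eq)
  then show "(affine u c \<circ> affine v d) x = affine (u * v) (u * d + c) x"
    using affine_closed[of x v d] by (simp add: affine_def[of u c] affine_def[of "u * v"])
      (simp add: affine_def algebra_simps)
qed

lemma affine_id: "affine 1 0 = id"
  by (auto simp: affine_def)

lemma affine_cong:
  assumes "[u = v] (mod q)" "[c = d] (mod q)"
  shows "affine u c = affine v d"
proof
  fix x
  have "[u * x + c = v * x + d] (mod q)"
    using assms by (intro cong_add cong_mult) auto
  then show "affine u c x = affine v d x"
    by (simp add: affine_def cong_def)
qed

text \<open>At level \<open>i\<close> a difference p^i e becomes p^i u e, and \<open>u\<close> is 1
  modulo \<open>p\<close>. Reduction modulo \<open>q\<close> only adds a multiple of p^(i+1), since
  \<open>i < n\<close>.\<close>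

lemma affine_chain_perms:
  assumes u: "[u = 1] (mod int p)"
  shows "affine u c \<in> chain_perms"
proof (rule chain_permsI)
  fix i x y
  assume i: "i < n" and xy: "x \<in> {0..<q}" "y \<in> {0..<q}"
    and "agree i x y"
  then obtain e where e: "x - y = int p ^ i * e"
    by (auto simp: agree_def digits_agree_iff)
  have "[affine u c x - affine u c y = (u * x + c) - (u * y + c)] (mod q)"
    using xy by (intro cong_diff) (simp_all add: affine_def)
  then have "[u * (x - y) = affine u c x - affine u c y] (mod q)"
    by (simp add: cong_sym algebra_simps)
  then obtain w where w: "affine u c x - affine u c y = u * (x - y) + q * w"
    by (metis cong_iff_lin)
  have "q = int p ^ i * (int p * int p ^ (n - Suc i))"
    using i by (simp flip: power_add power_Suc)
  then have "affine u c x - affine u c y = int p ^ i * (u * e + int p * (int p ^ (n - Suc i) * w))"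
    by (simp add: w e algebra_simps)
  then have "digit_diff i (affine u c x) (affine u c y) = u * e + int p * (int p ^ (n - Suc i) * w)"
    using p_pos by simp
  also have "[\<dots> = 1 * e + 0] (mod int p)"
    using u by (intro cong_add cong_mult) (auto simp: cong_0_iff)
  also have "1 * e + 0 = digit_diff i x y"
    using p_pos by (simp add: e)
  finally show "[digit_diff i (affine u c x) (affine u c y) = digit_diff i x y] (mod int p)" .
qed (rule affine_closed, assumption, simp only: affine_def if_False)

lemma translation_pow: "affine 1 1 [^]\<^bsub>fun_group chain_perms\<^esub> (z :: int) = affine 1 z"
proof -
  interpret K: group "fun_group chain_perms"
    by (rule group_chain_perms)
  have nat: "affine 1 1 ^^ k = affine 1 (int k)" for k
    by (induction k) (simp_all add: affine_id affine_comp add.commute)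
  have "inv\<^bsub>fun_group chain_perms\<^esub> affine 1 z = affine 1 (- z)" for z
    by (rule K.inv_equality) (simp_all add: affine_chain_perms affine_comp affine_id)
  then show ?thesis
    by (simp add: int_pow_def2 fun_group_nat_pow nat)
qed

lemma translation_neq_id:
  assumes "z \<noteq> 0" "nat \<bar>z\<bar> \<le> n"
  shows "affine 1 z \<noteq> id"
proof
  assume "affine 1 z = id"
  then have "affine 1 z 0 = 0"
    by simp
  moreover have "0 \<in> {0..<q}"
    using p_pos by simp
  ultimately have "z mod q = 0"
    unfolding affine_def by simp
  then have "q \<le> \<bar>z\<bar>"
    using assms(1) dvd_imp_le_int[of z q] by (simp add: dvd_eq_mod_eq_0)
  moreover have "n < p ^ n"
    using prime prime_gt_1_nat by (simp add: power_gt_expt)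
  ultimately show False
    using assms(2) by (simp flip: of_nat_power)
qed

end

text \<open>\<open>a\<close> acts on \<open>\<int>/p\<^sup>n\<int>\<close> as the translation by 1 and \<open>b\<close> as the multiplication by an inverse
  of \<open>c\<close>.\<close>

lemma G_affine_quotient:
  assumes p: "Factorial_Ring.prime p" and c: "[c = 1] (mod int p)" and m: "m = l * c" and "(z :: int) \<noteq> 0"
  obtains K :: "(int \<Rightarrow> int) monoid" and h where "finite_p_group p K" "h \<in> hom (G_group l m) K"
    "h (G_gen l m A [^]\<^bsub>G_group l m\<^esub> z) \<noteq> \<one>\<^bsub>K\<^esub>"
proof -
  interpret affine_chain p "nat \<bar>z\<bar>"
    by unfold_locales (rule p)
  interpret K: group "fun_group chain_perms"
    by (rule group_chain_perms)
  have "coprime c (int p)"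
    using c by (meson cong_imp_coprime coprime_1_left cong_sym)
  then obtain u where u: "[c * u = 1] (mod q)"
    by (metis cong_solve_coprime_int coprime_power_right_iff)
  \<comment> \<open>As \<open>z \<noteq> 0\<close>, the exponent of \<open>q\<close> is positive, so
    \<open>p\<close> divides \<open>q\<close>.\<close>
  have "[c * u = 1] (mod int p)"
    using u by (rule cong_dvd_modulus) (use assms(4) in \<open>simp add: dvd_power\<close>)
  moreover have "[c * u = 1 * u] (mod int p)"
    using c by (rule cong_scalar_right)
  ultimately have u1: "[u = 1] (mod int p)"
    by (metis cong_sym cong_trans mult_1)
  \<comment> \<open>Modulo \<open>q\<close>, the maps a^l b and b a^m send \<open>x\<close> to
    \<open>u * x + l\<close> and \<open>u * x + u * m\<close>, which agree because
    \<open>m = l * c\<close>.\<close>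
  have "[l * (c * u) = l * 1] (mod q)"
    using u by (rule cong_scalar_left)
  then have "affine u l = affine u (u * m)"
    by (intro affine_cong) (simp_all add: m cong_sym mult_ac)
  then obtain h where h: "h \<in> hom (G_group l m) (fun_group chain_perms)" "h (G_gen l m A) = affine 1 1"
    using K.G_group_universal[of "affine 1 1" "affine u 0" l m] u1
    by (auto simp: translation_pow affine_comp affine_chain_perms)
  interpret h: group_hom "G_group l m" "fun_group chain_perms" h
    using h(1) by (simp add: group_hom_def group_hom_axioms_def group_G_group K.is_group)
  show thesis
    by (rule that[OF finite_p_group_chain_perms h(1)])
      (use assms(4) in \<open>simp add: h.hom_int_pow h(2) translation_pow translation_neq_id\<close>)
qed

text \<open>With \<open>a\<close> mapped to the identity the relation holds for any image of
  \<open>b\<close>, here the translation by 1.\<close>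

lemma G_exponent_sum_quotient:
  assumes p: "Factorial_Ring.prime p" and "(z :: int) \<noteq> 0"
  obtains K :: "(int \<Rightarrow> int) monoid" and h where "finite_p_group p K" "h \<in> hom (G_group l m) K"
    "h (G_gen l m A) = \<one>\<^bsub>K\<^esub>" "h (G_gen l m B [^]\<^bsub>G_group l m\<^esub> z) \<noteq> \<one>\<^bsub>K\<^esub>"
proof -
  interpret affine_chain p "nat \<bar>z\<bar>"
    by unfold_locales (rule p)
  interpret K: group "fun_group chain_perms"
    by (rule group_chain_perms)
  have one: "\<one>\<^bsub>fun_group chain_perms\<^esub> [^]\<^bsub>fun_group chain_perms\<^esub> (k :: int) = id" for k
    by (simp only: K.int_pow_one) simp
  obtain h where h: "h \<in> hom (G_group l m) (fun_group chain_perms)" "h (G_gen l m A) = id"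
      "h (G_gen l m B) = affine 1 1"
    using K.G_group_universal[of id "affine 1 1" l m] one id_chain_perms
    by (auto simp: affine_chain_perms)
  interpret h: group_hom "G_group l m" "fun_group chain_perms" h
    using h(1) by (simp add: group_hom_def group_hom_axioms_def group_G_group K.is_group)
  show thesis
    by (rule that[OF finite_p_group_chain_perms h(1)])
      (use assms(2) in \<open>simp_all add: h.hom_int_pow h(2,3) translation_pow translation_neq_id\<close>)
qed


section \<open>The Magnus representation modulo \<open>p\<close>\<close>

text \<open>Since \<open>j * (p ^ r choose j)\<close> is a multiple of \<open>p ^ r\<close>, a
  binomial coefficient prime to \<open>p\<close> would force \<open>p ^ r\<close> to divide the
  smaller number \<open>j\<close>.\<close>

lemma prime_dvd_prime_power_choose:
  fixes p :: nat
  assumes p: "Factorial_Ring.prime p" and j: "0 < j" "j < p ^ r"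
  shows "p dvd p ^ r choose j"
proof (rule ccontr)
  assume "\<not> p dvd p ^ r choose j"
  then have "coprime (p ^ r) (p ^ r choose j)"
    using p by (simp add: prime_imp_coprime)
  moreover have "j * (p ^ r choose j) = p ^ r * (p ^ r - 1 choose (j - 1))"
    using times_binomial_minus1_eq[OF j(1)] .
  then have "p ^ r dvd j * (p ^ r choose j)"
    by simp
  ultimately have "p ^ r dvd j"
    by (simp add: coprime_dvd_mult_left_iff)
  with j show False
    by (simp add: nat_dvd_not_less)
qed

text \<open>Truncated Magnus representation along a word \<open>u\<close>: the generator \<open>c\<close> acts on \<open>(\<int>/p\<int>)\<^sup>D\<^sup>+\<^sup>1\<close>,
  \<open>D = length u\<close>, as \<open>1 + X\<^sub>c\<close>, where \<open>X\<^sub>c\<close> moves the \<open>i\<close>-th basis vector to the next one if the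
  \<open>i\<close>-th letter of \<open>u\<close> is \<open>c\<close>, and kills it otherwise.\<close>

locale magnus =
  fixes p :: nat and u :: "'g list"
  assumes prime: "Factorial_Ring.prime p"
begin

text \<open>Reduced entries, and zeros beyond \<open>length u\<close>, make equality of functions
  the equality of vectors over the field with \<open>p\<close> elements.\<close>

definition vectors :: "(nat \<Rightarrow> int) set" where
  "vectors = {v. \<forall>i. (i \<in> {..length u} \<longrightarrow> v i \<in> {0..<int p}) \<and> (i \<notin> {..length u} \<longrightarrow> v i = 0)}"

lemma p_pos: "int p > 0"
  using prime prime_gt_0_nat by simp

lemma vectors_mod: "v \<in> vectors \<Longrightarrow> v i mod int p = v i"
  by (cases "i \<le> length u") (auto simp: vectors_def)

text \<open>Agreement up to level \<open>i\<close> is equality of the first \<open>i\<close>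
  coordinates, a flag respected by unipotent triangular matrices.\<close>

sublocale p_chain p vectors "Suc (length u)" "\<lambda>i v w. v i - w i"
proof
  show "finite vectors"
    unfolding vectors_def by (intro finite_set_of_finite_funs) auto
next
  fix v w assume vw: "v \<in> vectors" "w \<in> vectors" "\<forall>k<Suc (length u). int p dvd v k - w k"
  show "v = w"
  proof
    fix i
    show "v i = w i"
    proof (cases "i \<le> length u")
      case True
      then show ?thesis
        using vw by (metis less_Suc_eq_le mod_eq_dvd_iff vectors_mod)
    next
      case False
      with vw(1,2) show ?thesis
        by (simp add: vectors_def)
    qed
  qed
qed (simp_all add: prime)

definition shift :: "'g \<Rightarrow> (nat \<Rightarrow> int) \<Rightarrow> nat \<Rightarrow> int" where
  "shift c v i = (if 0 < i \<and> i \<le> length u \<and> u ! (i - 1) = c then v (i - 1) else 0)"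

definition act :: "'g \<Rightarrow> (nat \<Rightarrow> int) \<Rightarrow> nat \<Rightarrow> int" where
  "act c v = (if v \<in> vectors then \<lambda>i. (v i + shift c v i) mod int p else v)"

lemma act_closed: "v \<in> vectors \<Longrightarrow> act c v \<in> vectors"
  using p_pos by (auto simp: act_def vectors_def shift_def)

lemma act_chain_perms: "act c \<in> chain_perms"
proof (rule chain_permsI)
  fix i v w assume vw: "v \<in> vectors" "w \<in> vectors" and ag: "agree i v w"
  have "int p dvd shift c v i - shift c w i"
    using ag by (simp add: shift_def agree_def)
  then have "[v i - w i + (shift c v i - shift c w i) = v i - w i + 0] (mod int p)"
    by (intro cong_add) (simp_all add: cong_0_iff)
  moreover have "[act c v i - act c w i = v i + shift c v i - (w i + shift c w i)] (mod int p)"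
    using vw by (intro cong_diff) (simp_all add: act_def)
  ultimately show "[act c v i - act c w i = v i - w i] (mod int p)"
    using cong_trans by (simp add: algebra_simps)
qed (rule act_closed, assumption, simp only: act_def if_False)

text \<open>The j-th power of X_c carries coordinate \<open>i - j\<close> to coordinate
  \<open>i\<close>, and only along \<open>j\<close> consecutive letters \<open>c\<close> of
  \<open>u\<close>.\<close>

lemma shift_funpow_nonzero:
  "(shift c ^^ j) v i \<noteq> 0 \<Longrightarrow> j \<le> i \<and> (\<forall>k. i - j \<le> k \<and> k < i \<longrightarrow> k < length u \<and> u ! k = c)"
proof (induction j arbitrary: i)
  case (Suc j)
  then have "shift c ((shift c ^^ j) v) i \<noteq> 0"
    by simp
  then have i: "0 < i" "i \<le> length u" "u ! (i - 1) = c" and "(shift c ^^ j) v (i - 1) \<noteq> 0"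
    unfolding shift_def[of c "(shift c ^^ j) v"] by (auto split: if_splits)
  then have IH: "j \<le> i - 1" "i - 1 - j \<le> k \<Longrightarrow> k < i - 1 \<Longrightarrow> k < length u \<and> u ! k = c" for k
    using Suc.IH[of "i - 1"] by simp_all
  have "k < length u \<and> u ! k = c" if "i - Suc j \<le> k" "k < i" for k
    using that i IH(2)[of k] by (cases "k = i - 1") auto
  with i IH(1) show ?case
    by auto
next
  case 0
  then show ?case
    by auto
qed

text \<open>The binomial theorem for the n-th power of 1 + X_c, by Pascal's rule.\<close>

lemma act_funpow_cong:
  assumes "v \<in> vectors"
  shows "[(act c ^^ n) v i = (\<Sum>j\<le>n. int (n choose j) * (shift c ^^ j) v i)] (mod int p)"
proof (induction n arbitrary: i)
  case (Suc n)
  let ?x = "\<lambda>j. (shift c ^^ j) v"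
  let ?w = "(act c ^^ n) v" and ?s = "\<lambda>i. \<Sum>j\<le>n. int (n choose j) * ?x j i"
  have "?w \<in> vectors"
    using chain_perms_closed[OF funpow_chain_perms[OF act_chain_perms] assms] .
  then have "[(act c ^^ Suc n) v i = ?w i + shift c ?w i] (mod int p)"
    by (simp add: act_def)
  also have "[?w i + shift c ?w i = ?s i + shift c ?s i] (mod int p)"
    using Suc[of i] Suc[of "i - 1"]
    by (intro cong_add) (simp_all add: shift_def[of c ?w] shift_def[of c ?s])
  also have "shift c ?s i = (\<Sum>j\<le>n. int (n choose j) * ?x (Suc j) i)"
  proof -
    define b where "b \<longleftrightarrow> 0 < i \<and> i \<le> length u \<and> u ! (i - 1) = c"
    have "?x (Suc j) i = (if b then ?x j (i - 1) else 0)" for j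
      by (simp add: shift_def[of c "?x j"] b_def)
    moreover have "shift c ?s i = (if b then ?s (i - 1) else 0)"
      by (simp add: shift_def[of c ?s] b_def)
    ultimately show ?thesis
      by (cases b) (simp_all del: funpow.simps)
  qed
  \<comment> \<open>The term added at \<open>Suc n\<close> is zero, as \<open>n choose Suc n\<close>
    vanishes; it aligns the two sums for Pascal's rule after the index shift.\<close>
  also have "?s i = (\<Sum>j\<le>Suc n. int (n choose j) * ?x j i)"
    by simp
  also have "\<dots> = ?x 0 i + (\<Sum>j\<le>n. int (n choose Suc j) * ?x (Suc j) i)"
    by (subst sum.atMost_Suc_shift) simp
  also have "\<dots> + (\<Sum>j\<le>n. int (n choose j) * ?x (Suc j) i) =
      ?x 0 i + (\<Sum>j\<le>n. int (Suc n choose Suc j) * ?x (Suc j) i)"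
    by (simp add: sum.distrib algebra_simps)
  also have "\<dots> = (\<Sum>j\<le>Suc n. int (Suc n choose j) * ?x j i)"
    by (subst sum.atMost_Suc_shift) simp
  finally show ?case .
qed simp

text \<open>Modulo \<open>p\<close> the inner binomial coefficients vanish, which leaves 1 plus the
  p^r-th power of X_c. The latter is zero without a run of \<open>p ^ r\<close> letters
  \<open>c\<close> in \<open>u\<close>.\<close>

lemma act_prime_power:
  assumes no_run: "\<And>w1 w2. u \<noteq> w1 @ replicate (p ^ r) c @ w2"
  shows "act c ^^ (p ^ r) = id"
proof
  fix v
  show "(act c ^^ (p ^ r)) v = id v"
  proof (cases "v \<in> vectors")
    case True
    let ?q = "p ^ r"
    have q: "?q > 0"
      using prime prime_gt_0_nat by simp
    have w: "(act c ^^ ?q) v \<in> vectors"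
      using chain_perms_closed[OF funpow_chain_perms[OF act_chain_perms] True] .
    have "(act c ^^ ?q) v i = v i" for i
    proof -
      have zero: "(shift c ^^ ?q) v i = 0"
      proof (rule ccontr)
        assume "(shift c ^^ ?q) v i \<noteq> 0"
        from shift_funpow_nonzero[OF this] have le: "?q \<le> i"
          and run: "\<And>k. i - ?q \<le> k \<Longrightarrow> k < i \<Longrightarrow> k < length u \<and> u ! k = c"
          by blast+
        have "i - 1 < length u"
          using run[of "i - 1"] q le by linarith
        then have i: "i \<le> length u"
          by simp
        have "take ?q (drop (i - ?q) u) = replicate ?q c"
          using i le run by (intro nth_equalityI) auto
        then have "u = take (i - ?q) u @ replicate ?q c @ drop ?q (drop (i - ?q) u)"
          by (metis append_take_drop_id)
        with no_run show False
          by blast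
      qed
      have "[(act c ^^ ?q) v i = (\<Sum>j\<le>?q. int (?q choose j) * (shift c ^^ j) v i)] (mod int p)"
        by (rule act_funpow_cong[OF True])
      also have "[(\<Sum>j\<le>?q. int (?q choose j) * (shift c ^^ j) v i) =
          (\<Sum>j\<le>?q. if j = 0 then v i else 0)] (mod int p)"
      proof (rule cong_sum)
        fix j assume "j \<in> {..?q}"
        moreover have "int p dvd int (?q choose j)" if "0 < j" "j < ?q"
          using prime_dvd_prime_power_choose[OF prime that] by simp
        ultimately show "[int (?q choose j) * (shift c ^^ j) v i = (if j = 0 then v i else 0)] (mod int p)"
          using zero q by (cases "j = 0"; cases "j = ?q") (auto simp: cong_0_iff)
      qed
      also have "(\<Sum>j\<le>?q. if j = 0 then v i else 0) = v i"
        by simp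
      finally have "(act c ^^ ?q) v i mod int p = v i mod int p"
        by (simp add: cong_def)
      then show ?thesis
        using True w by (simp add: vectors_mod)
    qed
    then show ?thesis
      by auto
  next
    case False
    with funpow_chain_perms[OF act_chain_perms[of c], of "p ^ r"] show ?thesis
      by (simp add: chain_perms_def permutes_def)
  qed
qed

text \<open>In the composition the last letter of \<open>rev u\<close> acts first, so letters act in
  the order of \<open>u\<close>. Each moves the topmost nonzero entry, which is 1, one coordinate
  up.\<close>

lemma act_word_leading:
  fixes e :: "nat \<Rightarrow> int"
  assumes "rev u = w1 @ w"
  defines "e \<equiv> \<lambda>i. if i = 0 then 1 else 0"
  defines "V \<equiv> \<lambda>w. foldr (\<lambda>c f. act c \<circ> f) w id e"
  shows "V w \<in> vectors \<and> V w (length w) = 1 \<and> (\<forall>i>length w. V w i = 0)"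
  using assms(1)
proof (induction w arbitrary: w1)
  case Nil
  have "e \<in> vectors"
    using prime_gt_1_nat[OF prime] by (simp add: vectors_def e_def)
  then show ?case
    by (simp add: V_def e_def)
next
  case (Cons c w)
  have V: "V (c # w) = act c (V w)"
    by (simp add: V_def)
  have "rev u = (w1 @ [c]) @ w"
    using Cons.prems by simp
  then have IH: "V w \<in> vectors" "V w (length w) = 1" "i > length w \<Longrightarrow> V w i = 0" for i
    using Cons.IH by blast+
  have u: "u = rev w @ c # rev w1"
    using Cons.prems by (simp add: rev_swap)
  then have "u ! length w = c" "length w < length u"
    by (simp_all add: nth_append)
  then have "V (c # w) (Suc (length w)) = 1"
    using IH prime_gt_1_nat[OF prime] by (simp add: V act_def shift_def)
  moreover have "V (c # w) i = 0" if "i > Suc (length w)" for i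
    using IH that by (simp add: V act_def shift_def)
  moreover have "V (c # w) \<in> vectors"
    using IH(1) by (simp add: V act_closed)
  ultimately show ?case
    by simp
qed

lemma act_word_neq_id:
  assumes "u \<noteq> []"
  shows "foldr (\<lambda>c f. act c \<circ> f) (rev u) id \<noteq> id"
proof
  assume *: "foldr (\<lambda>c f. act c \<circ> f) (rev u) id = id"
  from act_word_leading[of "[]" "rev u"] assms show False
    unfolding * by simp
qed

end

text \<open>A positive word without full runs survives in a free product of cyclic groups of orders
  \<open>p ^ e c\<close>. The representation is taken along \<open>rev w\<close> because the last
  letter of \<open>w\<close> acts first.\<close>

lemma prime_power_free_product_quotient:
  fixes w :: "'g list"
  assumes p: "Factorial_Ring.prime p" and w: "w \<noteq> []"
    and no_run: "\<And>c w1 w2. w \<noteq> w1 @ replicate (p ^ e c) c @ w2"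
  obtains K :: "((nat \<Rightarrow> int) \<Rightarrow> nat \<Rightarrow> int) monoid" and x where "finite_p_group p K"
    "\<And>c. x c \<in> carrier K" "\<And>c. x c [^]\<^bsub>K\<^esub> (p ^ e c) = \<one>\<^bsub>K\<^esub>"
    "foldr (\<lambda>c g. x c \<otimes>\<^bsub>K\<^esub> g) w \<one>\<^bsub>K\<^esub> \<noteq> \<one>\<^bsub>K\<^esub>"
proof -
  interpret magnus p "rev w"
    by unfold_locales (rule p)
  have "act c ^^ (p ^ e c) = id" for c
  proof (rule act_prime_power)
    fix w1 w2
    show "rev w \<noteq> w1 @ replicate (p ^ e c) c @ w2"
    proof
      assume "rev w = w1 @ replicate (p ^ e c) c @ w2"
      then have "w = rev w2 @ replicate (p ^ e c) c @ rev w1"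
        by (metis append_assoc rev_append rev_replicate rev_rev_ident)
      with no_run show False
        by blast
    qed
  qed
  moreover have "foldr (\<lambda>c f. act c \<circ> f) w id \<noteq> id"
    using act_word_neq_id w by simp
  ultimately show thesis
    by (intro that[OF finite_p_group_chain_perms, of act])
      (simp_all add: act_chain_perms fun_group_nat_pow del: length_rev)
qed


section \<open>Sufficiency\<close>

text \<open>A run starting inside the first block would consist of letters \<open>c\<close>. As it
  is longer than the block, it would continue into \<open>v\<close>, which does not begin with
  \<open>c\<close>.\<close>

lemma replicate_run_split:
  assumes eq: "replicate n c @ v = w1 @ replicate k d @ w2"
    and v: "v = [] \<or> hd v \<noteq> c" and nk: "c = d \<Longrightarrow> n < k" "k > 0"
  shows "\<exists>w1'. v = w1' @ replicate k d @ w2"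
proof -
  from eq consider us where "replicate n c @ us = w1" "v = us @ replicate k d @ w2"
    | us where "replicate n c = w1 @ us" "us @ v = replicate k d @ w2"
    by (auto simp: append_eq_append_conv2)
  then show ?thesis
  proof cases
    case 2
    show ?thesis
    proof (cases us)
      case Nil
      with 2 show ?thesis
        by (metis append_Nil)
    next
      case (Cons x xs)
      have us: "us = replicate (length us) c" "length us \<le> n"
        using 2(1) by (metis append_eq_conv_conj drop_replicate length_replicate,
          metis le_add2 length_append length_replicate)
      have "d = c"
        using 2(2) Cons us(1) nk(2) by (cases k; cases "length us") auto
      with nk us(2) have lt: "length us < k"
        by simp
      then have "replicate k d = us @ replicate (k - length us) c"
        using us(1) \<open>d = c\<close> by (metis le_add_diff_inverse less_imp_le replicate_add)
      with 2(2) have "v = replicate (k - length us) c @ w2"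
        by simp
      with v lt show ?thesis
        by (cases "k - length us") auto
    qed
  qed auto
qed

lemma syllables_no_run:
  fixes e :: "'g \<Rightarrow> nat"
  assumes "successively (\<lambda>x y. fst x \<noteq> fst y) ss"
    and "\<And>c n. (c, n) \<in> set ss \<Longrightarrow> 0 < n \<and> n < e c" and "e d > 0"
  shows "concat (map (\<lambda>(c, n). replicate n c) ss) \<noteq> w1 @ replicate (e d) d @ w2"
  using assms
proof (induction ss arbitrary: w1)
  case (Cons s ss)
  obtain c n where s: "s = (c, n)"
    by (cases s)
  let ?v = "concat (map (\<lambda>(c, n). replicate n c) ss)"
  have "?v = [] \<or> hd ?v \<noteq> c"
  proof (cases ss)
    case (Cons t ts)
    obtain c' n' where "t = (c', n')"
      by (cases t)
    with Cons Cons.prems s have "c' \<noteq> c" "n' > 0"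
      by auto
    with Cons \<open>t = (c', n')\<close> show ?thesis
      by (cases n') auto
  qed simp
  moreover have "?v \<noteq> w1' @ replicate (e d) d @ w2" for w1'
    using Cons.prems by (intro Cons.IH) (auto simp: successively_Cons)
  ultimately show ?case
    using replicate_run_split[of n c ?v w1 "e d" d w2] Cons.prems(2)[of c n] Cons.prems(3) s by auto
qed simp

section \<open>The case m = l or m = -l: normal forms over the normal subgroup generated by
  a^l\<close>

locale balanced_G =
  fixes l s :: int
  assumes l: "l \<noteq> 0" and s: "s * s = 1"
begin

abbreviation G where "G \<equiv> G_group l (l * s)"
abbreviation gn where "gn \<equiv> G_gen l (l * s)"

sublocale G: group G
  by (rule group_G_group)

text \<open>The order of a generator modulo a^l up to sign, with 0 for infinite order:
  \<open>0 dvd z\<close> holds for \<open>z = 0\<close> only, so divisibility treats both generators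
  alike.\<close>

definition ex :: "gen \<Rightarrow> int" where
  "ex c = (case c of A \<Rightarrow> l | B \<Rightarrow> 0)"

lemma ex_dvdE:
  assumes "ex c dvd z"
  obtains k where "gn c [^]\<^bsub>G\<^esub> z = gn A [^]\<^bsub>G\<^esub> (l * k)"
proof (cases c)
  case A
  with assms that show thesis
    by (auto simp: ex_def)
next
  case B
  with assms that[of 0] show thesis
    by (auto simp: ex_def)
qed

lemma b_conj: "inv\<^bsub>G\<^esub> gn B \<otimes>\<^bsub>G\<^esub> gn A [^]\<^bsub>G\<^esub> (l * k) \<otimes>\<^bsub>G\<^esub> gn B = gn A [^]\<^bsub>G\<^esub> (l * (s * k))"
proof -
  have "inv\<^bsub>G\<^esub> gn B \<otimes>\<^bsub>G\<^esub> (gn A [^]\<^bsub>G\<^esub> l) [^]\<^bsub>G\<^esub> k \<otimes>\<^bsub>G\<^esub> gn B = (gn A [^]\<^bsub>G\<^esub> (l * s)) [^]\<^bsub>G\<^esub> k"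
    using G_gen_relation[of l "l * s"] by (simp add: G.conj_int_pow)
  then show ?thesis
    by (simp add: G.int_pow_pow mult.assoc)
qed

text \<open>The subgroup generated by a^l is normal: \<open>b\<close> and, because
  \<open>s * s = 1\<close>, also its inverse conjugate its elements to their \<open>s\<close>-th
  powers.\<close>

lemma gen_commute:
  assumes z: "z \<in> {1, -1 :: int}"
  obtains k' where "gn c [^]\<^bsub>G\<^esub> z \<otimes>\<^bsub>G\<^esub> gn A [^]\<^bsub>G\<^esub> (l * k) = gn A [^]\<^bsub>G\<^esub> (l * k') \<otimes>\<^bsub>G\<^esub> gn c [^]\<^bsub>G\<^esub> z"
proof (cases c)
  case A
  then show thesis
    using that[of k] G.int_pow_mult[of "gn A" z "l * k"] G.int_pow_mult[of "gn A" "l * k" z]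
    by (simp add: add.commute)
next
  case B
  consider "z = 1" | "z = -1"
    using z by auto
  then show thesis
  proof cases
    case 1
    have "gn B \<otimes>\<^bsub>G\<^esub> gn A [^]\<^bsub>G\<^esub> (l * k) = gn B \<otimes>\<^bsub>G\<^esub> (inv\<^bsub>G\<^esub> gn B \<otimes>\<^bsub>G\<^esub> gn A [^]\<^bsub>G\<^esub> (l * (s * k)) \<otimes>\<^bsub>G\<^esub> gn B)"
      unfolding b_conj by (simp add: s flip: mult.assoc[of s])
    also have "\<dots> = gn A [^]\<^bsub>G\<^esub> (l * (s * k)) \<otimes>\<^bsub>G\<^esub> gn B"
      by (simp flip: G.m_assoc)
    finally show thesis
      using that[of "s * k"] B 1 by simp
  next
    case 2
    have "inv\<^bsub>G\<^esub> gn B \<otimes>\<^bsub>G\<^esub> gn A [^]\<^bsub>G\<^esub> (l * k) =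
        inv\<^bsub>G\<^esub> gn B \<otimes>\<^bsub>G\<^esub> gn A [^]\<^bsub>G\<^esub> (l * k) \<otimes>\<^bsub>G\<^esub> gn B \<otimes>\<^bsub>G\<^esub> inv\<^bsub>G\<^esub> gn B"
      by (simp add: G.m_assoc)
    also have "\<dots> = gn A [^]\<^bsub>G\<^esub> (l * (s * k)) \<otimes>\<^bsub>G\<^esub> inv\<^bsub>G\<^esub> gn B"
      by (simp only: b_conj)
    finally show thesis
      using that[of "s * k"] B 2 by (simp add: G.int_pow_neg)
  qed
qed

definition syl :: "(gen \<times> int) list \<Rightarrow> gen word set" where
  "syl ss = foldr (\<lambda>x g. gn (fst x) [^]\<^bsub>G\<^esub> snd x \<otimes>\<^bsub>G\<^esub> g) ss \<one>\<^bsub>G\<^esub>"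

lemma syl_simps [simp]:
  "syl [] = \<one>\<^bsub>G\<^esub>" "syl (x # ss) = gn (fst x) [^]\<^bsub>G\<^esub> snd x \<otimes>\<^bsub>G\<^esub> syl ss"
  by (simp_all add: syl_def)

lemma syl_closed [simp]: "syl ss \<in> carrier G"
  by (induction ss) auto

text \<open>Alternating words for the quotient by a^l, a free product of two cyclic groups.
  Exponents are only kept nontrivial here and get reduced in \<open>hom_syl\<close>.\<close>

definition normal_syllables :: "(gen \<times> int) list \<Rightarrow> bool" where
  "normal_syllables ss \<longleftrightarrow> successively (\<lambda>x y. fst x \<noteq> fst y) ss \<and> (\<forall>x\<in>set ss. \<not> ex (fst x) dvd snd x)"

text \<open>The new syllable merges with a first one in the same generator; an exponent that becomes
  trivial modulo \<open>ex c\<close> moves into the power of a^l.\<close>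

lemma normal_syllables_mult:
  fixes z :: int
  assumes ss: "normal_syllables ss"
  shows "\<exists>k ss'. normal_syllables ss' \<and> gn c [^]\<^bsub>G\<^esub> z \<otimes>\<^bsub>G\<^esub> syl ss = gn A [^]\<^bsub>G\<^esub> (l * k) \<otimes>\<^bsub>G\<^esub> syl ss'"
proof (cases "ss \<noteq> [] \<and> fst (hd ss) = c")
  case True
  then obtain n t where t: "ss = (c, n) # t"
    by (cases ss) auto
  then have eq: "gn c [^]\<^bsub>G\<^esub> z \<otimes>\<^bsub>G\<^esub> syl ss = gn c [^]\<^bsub>G\<^esub> (z + n) \<otimes>\<^bsub>G\<^esub> syl t"
    by (simp add: G.int_pow_mult G.m_assoc)
  have nt: "normal_syllables t"
    using ss t by (auto simp: normal_syllables_def successively_Cons)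
  show ?thesis
  proof (cases "ex c dvd z + n")
    case True
    with eq nt show ?thesis
      by (metis ex_dvdE)
  next
    case False
    then have "normal_syllables ((c, z + n) # t)"
      using ss t by (auto simp: normal_syllables_def successively_Cons)
    moreover have "gn c [^]\<^bsub>G\<^esub> z \<otimes>\<^bsub>G\<^esub> syl ss = gn A [^]\<^bsub>G\<^esub> (l * 0) \<otimes>\<^bsub>G\<^esub> syl ((c, z + n) # t)"
      by (simp add: eq)
    ultimately show ?thesis
      by blast
  qed
next
  case hd: False
  show ?thesis
  proof (cases "ex c dvd z")
    case True
    with ss show ?thesis
      by (metis ex_dvdE)
  next
    case False
    then have "normal_syllables ((c, z) # ss)"
      using ss hd by (auto simp: normal_syllables_def successively_Cons)
    moreover have "gn c [^]\<^bsub>G\<^esub> z \<otimes>\<^bsub>G\<^esub> syl ss = gn A [^]\<^bsub>G\<^esub> (l * 0) \<otimes>\<^bsub>G\<^esub> syl ((c, z) # ss)"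
      by simp
    ultimately show ?thesis
      by blast
  qed
qed

lemma normal_form:
  assumes "g \<in> carrier G"
  shows "\<exists>k ss. normal_syllables ss \<and> g = gn A [^]\<^bsub>G\<^esub> (l * k) \<otimes>\<^bsub>G\<^esub> syl ss"
  using assms
proof (induction rule: G_group_induct)
  case one
  have "normal_syllables []" "\<one>\<^bsub>G\<^esub> = gn A [^]\<^bsub>G\<^esub> (l * 0) \<otimes>\<^bsub>G\<^esub> syl []"
    by (simp_all add: normal_syllables_def)
  then show ?case
    by blast
next
  case (mult g c z)
  then obtain k ss where ss: "normal_syllables ss" "g = gn A [^]\<^bsub>G\<^esub> (l * k) \<otimes>\<^bsub>G\<^esub> syl ss"
    by blast
  obtain k' where k': "gn c [^]\<^bsub>G\<^esub> z \<otimes>\<^bsub>G\<^esub> gn A [^]\<^bsub>G\<^esub> (l * k) = gn A [^]\<^bsub>G\<^esub> (l * k') \<otimes>\<^bsub>G\<^esub> gn c [^]\<^bsub>G\<^esub> z"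
    using gen_commute[OF mult.hyps(2)] by metis
  obtain k'' ss' where ss': "normal_syllables ss'"
      "gn c [^]\<^bsub>G\<^esub> z \<otimes>\<^bsub>G\<^esub> syl ss = gn A [^]\<^bsub>G\<^esub> (l * k'') \<otimes>\<^bsub>G\<^esub> syl ss'"
    using normal_syllables_mult[OF ss(1)] by metis
  have "gn c [^]\<^bsub>G\<^esub> z \<otimes>\<^bsub>G\<^esub> g = gn c [^]\<^bsub>G\<^esub> z \<otimes>\<^bsub>G\<^esub> gn A [^]\<^bsub>G\<^esub> (l * k) \<otimes>\<^bsub>G\<^esub> syl ss"
    by (simp add: ss(2) G.m_assoc)
  also have "\<dots> = gn A [^]\<^bsub>G\<^esub> (l * k') \<otimes>\<^bsub>G\<^esub> (gn c [^]\<^bsub>G\<^esub> z \<otimes>\<^bsub>G\<^esub> syl ss)"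
    by (simp add: k' G.m_assoc)
  also have "\<dots> = gn A [^]\<^bsub>G\<^esub> (l * (k' + k'')) \<otimes>\<^bsub>G\<^esub> syl ss'"
    by (simp add: ss'(2) distrib_left G.int_pow_mult G.m_assoc)
  finally show ?case
    using ss'(1) by blast
qed

text \<open>In \<open>K\<close> exponents may be replaced by residues, which turns syllables with
  negative exponents into a positive word for the Magnus representation.\<close>

lemma hom_syl:
  assumes K: "group K" and h: "h \<in> hom G K" "\<And>c. h (gn c) = x c" "\<And>c. x c \<in> carrier K"
    and e: "\<And>c. x c [^]\<^bsub>K\<^esub> e c = \<one>\<^bsub>K\<^esub>" "\<And>c. e c > (0 :: nat)"
  shows "h (syl ss) = foldr (\<lambda>c g. x c \<otimes>\<^bsub>K\<^esub> g)
    (concat (map (\<lambda>(c, n). replicate n c) (map (\<lambda>(c, n). (c, nat (n mod int (e c)))) ss))) \<one>\<^bsub>K\<^esub>"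
proof -
  interpret K: group K
    by fact
  interpret h: group_hom G K h
    using h(1) by unfold_locales
  have closed: "foldr (\<lambda>c g. x c \<otimes>\<^bsub>K\<^esub> g) w \<one>\<^bsub>K\<^esub> \<in> carrier K" for w
    by (induction w) (auto simp: h(3))
  have rep: "foldr (\<lambda>c g. x c \<otimes>\<^bsub>K\<^esub> g) (replicate n c) y = x c [^]\<^bsub>K\<^esub> n \<otimes>\<^bsub>K\<^esub> y"
    if "y \<in> carrier K" for n c y
  proof (induction n)
    case (Suc n)
    then have "foldr (\<lambda>c g. x c \<otimes>\<^bsub>K\<^esub> g) (replicate (Suc n) c) y = x c \<otimes>\<^bsub>K\<^esub> (x c [^]\<^bsub>K\<^esub> n \<otimes>\<^bsub>K\<^esub> y)"
      by simp
    also have "\<dots> = x c [^]\<^bsub>K\<^esub> Suc n \<otimes>\<^bsub>K\<^esub> y"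
      using that unfolding K.nat_pow_Suc2[OF h(3)] by (simp add: K.m_assoc h(3))
    finally show ?case .
  qed (use that in simp)
  have pow: "x c [^]\<^bsub>K\<^esub> n = x c [^]\<^bsub>K\<^esub> nat (n mod int (e c))" for c and n :: int
  proof -
    have "x c [^]\<^bsub>K\<^esub> n = x c [^]\<^bsub>K\<^esub> (n mod int (e c))"
      using e(1)[of c] by (intro K.int_pow_cong[OF h(3), of _ "int (e c)"]) (simp_all add: int_pow_int)
    also have "\<dots> = x c [^]\<^bsub>K\<^esub> int (nat (n mod int (e c)))"
      using e(2)[of c] by simp
    finally show ?thesis
      by (simp only: int_pow_int)
  qed
  show ?thesis
  proof (induction ss)
    case (Cons t ss)
    then show ?case
      by (cases t) (simp add: h.hom_int_pow h(2) rep closed del: foldr_replicate flip: pow)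
  qed simp
qed

lemma separating_hom_syl:
  assumes p: "Factorial_Ring.prime p" and lp: "l = int p ^ r"
    and ss: "normal_syllables ss" "ss \<noteq> []"
  obtains K :: "((nat \<Rightarrow> int) \<Rightarrow> nat \<Rightarrow> int) monoid" and h where
    "finite_p_group p K" "h \<in> hom G K"
    "h (gn A [^]\<^bsub>G\<^esub> (l * k) \<otimes>\<^bsub>G\<^esub> syl ss) \<noteq> \<one>\<^bsub>K\<^esub>"
proof -
  \<comment> \<open>Exponents are bounded by \<open>N < p ^ N\<close>, so no syllable in
    \<open>b\<close> dies modulo \<open>p ^ N\<close>; those in \<open>a\<close> survive modulo
    \<open>p ^ r\<close>, which is \<open>l\<close>.\<close>
  define N where "N = Max ((\<lambda>x. nat \<bar>snd x\<bar>) ` set ss)"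
  define f where "f c = (case c of A \<Rightarrow> r | B \<Rightarrow> N)" for c
  have p1: "p > 1"
    using p prime_gt_1_nat by simp
  define ss' where "ss' = map (\<lambda>(c, n). (c, nat (n mod int (p ^ f c)))) ss"
  define w where "w = concat (map (\<lambda>(c, n). replicate n c) ss')"
  have not_dvd: "\<not> int (p ^ f c) dvd n" if "(c, n) \<in> set ss" for c n
  proof (cases c)
    case A
    then have "\<not> l dvd n"
      using ss(1) that by (auto simp: normal_syllables_def ex_def)
    then show ?thesis
      using A by (simp add: lp f_def)
  next
    case B
    have "n \<noteq> 0"
      using ss(1) that B by (auto simp: normal_syllables_def ex_def)
    moreover have "nat \<bar>n\<bar> \<le> N"
      unfolding N_def using that by (intro Max_ge) force+
    moreover have "N < p ^ N"
      using p1 by (simp add: power_gt_expt)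
    ultimately have "\<bar>n\<bar> < int (p ^ N)"
      by linarith
    with \<open>n \<noteq> 0\<close> B show ?thesis
      using dvd_imp_le_int[of n "int (p ^ N)"] by (auto simp: f_def)
  qed
  have pos: "0 < n \<and> n < p ^ f c" if cn: "(c, n) \<in> set ss'" for c n
  proof -
    obtain z where z: "(c, z) \<in> set ss" "n = nat (z mod int (p ^ f c))"
      using cn by (auto simp: ss'_def simp del: of_nat_power)
    have "z mod int (p ^ f c) \<noteq> 0"
      using not_dvd[OF z(1)] unfolding dvd_eq_mod_eq_0 .
    moreover have "z mod int (p ^ f c) \<ge> 0" "z mod int (p ^ f c) < int (p ^ f c)"
      using p1 by simp_all
    ultimately show ?thesis
      unfolding z(2) by linarith
  qed
  have "successively (\<lambda>x y. fst x \<noteq> fst y) ss'"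
    using ss(1) by (simp add: ss'_def normal_syllables_def successively_map case_prod_beta)
  then have "w \<noteq> w1 @ replicate (p ^ f c) c @ w2" for w1 w2 c
    unfolding w_def using pos p1 by (intro syllables_no_run[where e = "\<lambda>c. p ^ f c"]) auto
  moreover have "w \<noteq> []"
  proof -
    obtain c n t where "ss' = (c, n) # t"
      using ss(2) by (cases ss) (auto simp: ss'_def)
    with pos[of c n] show ?thesis
      by (simp add: w_def)
  qed
  ultimately obtain K :: "((nat \<Rightarrow> int) \<Rightarrow> nat \<Rightarrow> int) monoid" and x where K: "finite_p_group p K"
    and x: "\<And>c. x c \<in> carrier K" "\<And>c. x c [^]\<^bsub>K\<^esub> (p ^ f c) = \<one>\<^bsub>K\<^esub>"
    and w: "foldr (\<lambda>c g. x c \<otimes>\<^bsub>K\<^esub> g) w \<one>\<^bsub>K\<^esub> \<noteq> \<one>\<^bsub>K\<^esub>"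
    using prime_power_free_product_quotient[OF p, of w f] by metis
  interpret K: group K
    using K by (simp add: finite_p_group_def)
  \<comment> \<open>Both a^l and a^m become trivial in \<open>K\<close>, so the relation holds
    whatever \<open>x B\<close> is.\<close>
  have xl: "x A [^]\<^bsub>K\<^esub> l = \<one>\<^bsub>K\<^esub>"
    using x(2)[of A] by (metis f_def gen.simps(3) int_pow_int lp of_nat_power)
  then have xlk: "x A [^]\<^bsub>K\<^esub> (l * k) = \<one>\<^bsub>K\<^esub>" for k
    by (intro K.int_pow_eq_one_dvd[OF x(1) xl]) simp
  have "x A [^]\<^bsub>K\<^esub> l \<otimes>\<^bsub>K\<^esub> x B = x B \<otimes>\<^bsub>K\<^esub> x A [^]\<^bsub>K\<^esub> (l * s)"
    by (simp add: xl xlk x(1))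
  then obtain h where h: "h \<in> hom G K" "h (gn A) = x A" "h (gn B) = x B"
    using K.G_group_universal[OF x(1) x(1)] by metis
  then have hx: "h (gn c) = x c" for c
    by (cases c) simp_all
  interpret h: group_hom G K h
    using h(1) by unfold_locales
  have "h (syl ss) = foldr (\<lambda>c g. x c \<otimes>\<^bsub>K\<^esub> g) w \<one>\<^bsub>K\<^esub>"
    unfolding w_def ss'_def by (rule hom_syl[OF K.is_group h(1) hx x]) (use p1 in simp)
  then have "h (gn A [^]\<^bsub>G\<^esub> (l * k) \<otimes>\<^bsub>G\<^esub> syl ss) \<noteq> \<one>\<^bsub>K\<^esub>"
    using w h.hom_closed[of "syl ss"] by (simp add: h.hom_int_pow hx xlk)
  with K h(1) show thesis
    by (rule that)
qed

lemma residually_finite_p: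
  assumes p: "Factorial_Ring.prime p" and lp: "l = int p ^ r" and sp: "[s = 1] (mod int p)"
  shows "residually_finite_p p G"
  unfolding residually_finite_p_def
proof (intro ballI impI)
  fix g assume g: "g \<in> carrier G" "g \<noteq> \<one>\<^bsub>G\<^esub>"
  obtain k ss where ss: "normal_syllables ss" and gk: "g = gn A [^]\<^bsub>G\<^esub> (l * k) \<otimes>\<^bsub>G\<^esub> syl ss"
    using normal_form[OF g(1)] by blast
  show "\<exists>(H :: nat monoid) h. finite_p_group p H \<and> h \<in> epi G H \<and> h g \<noteq> \<one>\<^bsub>H\<^esub>"
  proof (cases "ss = []")
    case True
    then have gA: "g = gn A [^]\<^bsub>G\<^esub> (l * k)"
      by (simp add: gk)
    then have "l * k \<noteq> 0"
      using g(2) by (metis int_pow_0)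
    then show ?thesis
      using G_affine_quotient[OF p sp refl, of "l * k" l] separating_homI[OF G.is_group _ p _ g(1)]
      unfolding gA by metis
  next
    case False
    show ?thesis
      using separating_hom_syl[OF p lp ss False, of k] separating_homI[OF G.is_group _ p _ g(1)]
      unfolding gk by metis
  qed
qed

end

section \<open>The case l = 1: elements in the form b^i a^k b^(-j)\<close>

context
  fixes m :: int
begin

interpretation G: group "G_group 1 m"
  by (rule group_G_group)

private abbreviation "a \<equiv> G_gen 1 m A"
private abbreviation "b \<equiv> G_gen 1 m B"

text \<open>Powers of \<open>a\<close> pass b^i to the right when raised to \<open>m ^ i\<close>,
  and a new inverse of \<open>b\<close> either cancels or, if \<open>i = 0\<close>, passes a^k to
  the right end.\<close>

lemma G_one_normal_form:
  assumes "g \<in> carrier (G_group 1 m)"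
  shows "\<exists>(i :: nat) (k :: int) (j :: nat). g = b [^]\<^bsub>G_group 1 m\<^esub> int i \<otimes>\<^bsub>G_group 1 m\<^esub> a [^]\<^bsub>G_group 1 m\<^esub> k
    \<otimes>\<^bsub>G_group 1 m\<^esub> b [^]\<^bsub>G_group 1 m\<^esub> (- int j)"
  using assms
proof (induction rule: G_group_induct)
  case one
  show ?case
    by (rule exI[of _ 0], rule exI[of _ 0], rule exI[of _ 0]) simp
next
  case (mult g c z)
  obtain i j and k :: int where g: "g = b [^]\<^bsub>G_group 1 m\<^esub> int i \<otimes>\<^bsub>G_group 1 m\<^esub> a [^]\<^bsub>G_group 1 m\<^esub> k
    \<otimes>\<^bsub>G_group 1 m\<^esub> b [^]\<^bsub>G_group 1 m\<^esub> (- int j)"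
    using mult.IH by blast
  have rel: "inv\<^bsub>G_group 1 m\<^esub> b \<otimes>\<^bsub>G_group 1 m\<^esub> a \<otimes>\<^bsub>G_group 1 m\<^esub> b = a [^]\<^bsub>G_group 1 m\<^esub> m"
    using G_gen_relation[of 1 m] by simp
  have az: "a [^]\<^bsub>G_group 1 m\<^esub> z \<otimes>\<^bsub>G_group 1 m\<^esub> b [^]\<^bsub>G_group 1 m\<^esub> int i =
      b [^]\<^bsub>G_group 1 m\<^esub> int i \<otimes>\<^bsub>G_group 1 m\<^esub> a [^]\<^bsub>G_group 1 m\<^esub> (m ^ i * z)" for z i
  proof -
    have "inv\<^bsub>G_group 1 m\<^esub> (b [^]\<^bsub>G_group 1 m\<^esub> i) \<otimes>\<^bsub>G_group 1 m\<^esub> a [^]\<^bsub>G_group 1 m\<^esub> z \<otimes>\<^bsub>G_group 1 m\<^esub> b [^]\<^bsub>G_group 1 m\<^esub> i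
        = a [^]\<^bsub>G_group 1 m\<^esub> (m ^ i * z)"
      by (simp add: G.conj_int_pow G.conj_pow_iterate[OF _ _ rel] G.int_pow_pow)
    then show ?thesis
      by (simp add: int_pow_int G.m_assoc G.inv_solve_left')
  qed
  show ?case
  proof (cases c)
    case A
    have "a [^]\<^bsub>G_group 1 m\<^esub> z \<otimes>\<^bsub>G_group 1 m\<^esub> g = b [^]\<^bsub>G_group 1 m\<^esub> int i \<otimes>\<^bsub>G_group 1 m\<^esub> a [^]\<^bsub>G_group 1 m\<^esub> (m ^ i * z + k)
        \<otimes>\<^bsub>G_group 1 m\<^esub> b [^]\<^bsub>G_group 1 m\<^esub> (- int j)"
      by (simp add: g G.int_pow_mult az flip: G.m_assoc)
    with A show ?thesis
      by blast
  next
    case B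
    have bz: "b [^]\<^bsub>G_group 1 m\<^esub> z \<otimes>\<^bsub>G_group 1 m\<^esub> g = b [^]\<^bsub>G_group 1 m\<^esub> (z + int i) \<otimes>\<^bsub>G_group 1 m\<^esub> a [^]\<^bsub>G_group 1 m\<^esub> k
        \<otimes>\<^bsub>G_group 1 m\<^esub> b [^]\<^bsub>G_group 1 m\<^esub> (- int j)"
      by (simp add: g G.int_pow_mult flip: G.m_assoc)
    show ?thesis
    proof (cases "z + int i \<ge> 0")
      case True
      then have "z + int i = int (nat (z + int i))"
        by simp
      with B bz show ?thesis
        by metis
    next
      case False
      \<comment> \<open>The exponent drops below 0 only for \<open>i = 0\<close> and
        \<open>z = -1\<close>.\<close>
      with mult.hyps(2) have zi: "z + int i = - 1"
        by auto
      have "b [^]\<^bsub>G_group 1 m\<^esub> (-1 :: int) \<otimes>\<^bsub>G_group 1 m\<^esub> a [^]\<^bsub>G_group 1 m\<^esub> k =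
          a [^]\<^bsub>G_group 1 m\<^esub> (m * k) \<otimes>\<^bsub>G_group 1 m\<^esub> b [^]\<^bsub>G_group 1 m\<^esub> (-1 :: int)"
      proof -
        have "inv\<^bsub>G_group 1 m\<^esub> b \<otimes>\<^bsub>G_group 1 m\<^esub> a [^]\<^bsub>G_group 1 m\<^esub> k =
            inv\<^bsub>G_group 1 m\<^esub> b \<otimes>\<^bsub>G_group 1 m\<^esub> (a [^]\<^bsub>G_group 1 m\<^esub> k \<otimes>\<^bsub>G_group 1 m\<^esub> b [^]\<^bsub>G_group 1 m\<^esub> int 1)
              \<otimes>\<^bsub>G_group 1 m\<^esub> inv\<^bsub>G_group 1 m\<^esub> b"
          by (simp add: G.m_assoc)
        also have "\<dots> = a [^]\<^bsub>G_group 1 m\<^esub> (m * k) \<otimes>\<^bsub>G_group 1 m\<^esub> inv\<^bsub>G_group 1 m\<^esub> b"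
          unfolding az by (simp flip: G.m_assoc)
        finally show ?thesis
          by (simp add: G.int_pow_neg)
      qed
      then have "b [^]\<^bsub>G_group 1 m\<^esub> z \<otimes>\<^bsub>G_group 1 m\<^esub> g = b [^]\<^bsub>G_group 1 m\<^esub> int 0 \<otimes>\<^bsub>G_group 1 m\<^esub> a [^]\<^bsub>G_group 1 m\<^esub> (m * k)
        \<otimes>\<^bsub>G_group 1 m\<^esub> b [^]\<^bsub>G_group 1 m\<^esub> (- int (Suc j))"
        unfolding bz zi by (simp add: G.m_assoc flip: G.int_pow_mult)
      with B show ?thesis
        by blast
    qed
  qed
qed

lemma residually_finite_p_one:
  assumes p: "Factorial_Ring.prime p" and m: "[m = 1] (mod int p)"
  shows "residually_finite_p p (G_group 1 m)"
  unfolding residually_finite_p_def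
proof (intro ballI impI)
  fix g assume g: "g \<in> carrier (G_group 1 m)" "g \<noteq> \<one>\<^bsub>G_group 1 m\<^esub>"
  obtain i k j where gk: "g = b [^]\<^bsub>G_group 1 m\<^esub> int i \<otimes>\<^bsub>G_group 1 m\<^esub> a [^]\<^bsub>G_group 1 m\<^esub> (k :: int)
    \<otimes>\<^bsub>G_group 1 m\<^esub> b [^]\<^bsub>G_group 1 m\<^esub> (- int j)"
    using G_one_normal_form[OF g(1)] by blast
  have "\<exists>(K :: (int \<Rightarrow> int) monoid) h. finite_p_group p K \<and> h \<in> hom (G_group 1 m) K \<and> h g \<noteq> \<one>\<^bsub>K\<^esub>"
  proof (cases "i = j")
    case True
    \<comment> \<open>For \<open>i = j\<close> the element is a conjugate of a^k, which an affine
      quotient detects.\<close>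
    have k: "k \<noteq> 0"
      using g(2) True by (auto simp: gk simp flip: G.int_pow_mult)
    obtain K :: "(int \<Rightarrow> int) monoid" and h where K: "finite_p_group p K" and h: "h \<in> hom (G_group 1 m) K"
      and hk: "h (a [^]\<^bsub>G_group 1 m\<^esub> k) \<noteq> \<one>\<^bsub>K\<^esub>"
      using G_affine_quotient[OF p m, of m 1 k] k by auto
    interpret h: group_hom "G_group 1 m" K h
      using K h by (simp add: finite_p_group_def group_hom_def group_hom_axioms_def)
    have "h g \<noteq> \<one>\<^bsub>K\<^esub>"
    proof
      assume "h g = \<one>\<^bsub>K\<^esub>"
      then have "h b [^]\<^bsub>K\<^esub> int j \<otimes>\<^bsub>K\<^esub> h (a [^]\<^bsub>G_group 1 m\<^esub> k) \<otimes>\<^bsub>K\<^esub> inv\<^bsub>K\<^esub> (h b [^]\<^bsub>K\<^esub> int j) = \<one>\<^bsub>K\<^esub>"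
        by (simp add: gk True h.hom_int_pow h.H.int_pow_neg)
      then have "h b [^]\<^bsub>K\<^esub> int j \<otimes>\<^bsub>K\<^esub> h (a [^]\<^bsub>G_group 1 m\<^esub> k) = h b [^]\<^bsub>K\<^esub> int j"
        by (simp add: h.H.inv_solve_right')
      then show False
        using hk by simp
    qed
    with K h show ?thesis
      by blast
  next
    case False
    \<comment> \<open>The exponent sum of \<open>b\<close>; it is all that remains once
      \<open>a\<close> is mapped to the identity.\<close>
    then have "int i - int j \<noteq> 0"
      by simp
    from G_exponent_sum_quotient[OF p this, of 1 m]
    obtain K :: "(int \<Rightarrow> int) monoid" and h where K: "finite_p_group p K" and h: "h \<in> hom (G_group 1 m) K"
      and ha: "h a = \<one>\<^bsub>K\<^esub>" and hb: "h (b [^]\<^bsub>G_group 1 m\<^esub> (int i - int j)) \<noteq> \<one>\<^bsub>K\<^esub>"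
      by metis
    interpret h: group_hom "G_group 1 m" K h
      using K h by (simp add: finite_p_group_def group_hom_def group_hom_axioms_def)
    have "h g = h (b [^]\<^bsub>G_group 1 m\<^esub> (int i - int j))"
      by (simp add: gk ha h.hom_int_pow h.H.int_pow_diff h.H.int_pow_neg)
    with K h hb show ?thesis
      by auto
  qed
  then show "\<exists>(H :: nat monoid) h. finite_p_group p H \<and> h \<in> epi (G_group 1 m) H \<and> h g \<noteq> \<one>\<^bsub>H\<^esub>"
    using separating_homI[OF G.is_group _ p _ g(1)] by blast
qed

end

theorem theorem3:
  fixes p :: nat and l m :: int
  assumes "Factorial_Ring.prime p" and "\<bar>m\<bar> \<ge> l" and "l > 0"
  shows "residually_finite_p p (G_group l m) \<longleftrightarrow>
    (l = 1 \<and> [m = 1] (mod int p)) \<or>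
    (\<bar>m\<bar> = l \<and> (\<exists>r :: nat. l = int p ^ r) \<and> (m = - l \<longrightarrow> p = 2))"
proof
  assume "residually_finite_p p (G_group l m)"
  with assms show "(l = 1 \<and> [m = 1] (mod int p)) \<or>
    (\<bar>m\<bar> = l \<and> (\<exists>r :: nat. l = int p ^ r) \<and> (m = - l \<longrightarrow> p = 2))"
    by (rule residually_finite_p_necessary)
next
  assume "(l = 1 \<and> [m = 1] (mod int p)) \<or>
    (\<bar>m\<bar> = l \<and> (\<exists>r :: nat. l = int p ^ r) \<and> (m = - l \<longrightarrow> p = 2))"
  then consider "l = 1" "[m = 1] (mod int p)"
    | r where "\<bar>m\<bar> = l" "l = int p ^ r" "m = - l \<longrightarrow> p = 2"
    by blast
  then show "residually_finite_p p (G_group l m)"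
  proof cases
    case 1
    then show ?thesis
      using residually_finite_p_one[OF assms(1)] by simp
  next
    case 2
    \<comment> \<open>The sign of \<open>m\<close> is 1 modulo \<open>p\<close> in either case,
      since -1 occurs only with \<open>p = 2\<close>.\<close>
    define s where "s = sgn m"
    have m: "m = l * s"
      using 2(1) by (metis s_def abs_mult_sgn)
    have "[s = 1] (mod int p)"
    proof (cases "m > 0")
      case False
      then have "m = - l" "s = - 1"
        using 2(1) assms by (auto simp: s_def sgn_if)
      then show ?thesis
        using 2(3) by (simp add: cong_iff_dvd_diff)
    qed (simp add: s_def)
    moreover have "balanced_G l s"
      using assms by unfold_locales (auto simp: s_def sgn_if)
    ultimately show ?thesis
      unfolding m using balanced_G.residually_finite_p[OF _ assms(1) 2(2)] by blast
  qed
qed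

end
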